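(* Let $G$ be a finitely generated commutative group and let $S$ be any finite system of elements generating $G$ as a semigroup. Then the absolute $\mathscr{A}_S(G)$ is homeomorphic to the closed disk of dimension equal to the rank of the group $G$. The main part of the absolute corresponds (under the homeomorphism) to the interior of the disk.
   Context: A finite system of semigroup generators $S$ of a commutative group $G$ (written additively) is a finite nonempty family of elements of $G$, repetitions allowed (repeated elements being treated as distinct members of $S$), such that every element of $G$ is a sum of a finite sequence of members of $S$. The Cayley graph of $(G,S)$ has vertex set $G$ and, for every vertex $g$ and every $s\in S$, a directed edge marked by $s$ from $g$ to $g+s$; the distinguished vertex is $0$. The space $\mathscr{P}$ of infinite paths starting at $0$ is identified, via sequences of edge marks, with $S^{\mathbb{N}}$ with the product topology. The measure of a finite path starting at $0$ is the measure of the cylinder of all infinite paths beginning with it. A Borel probability measure $\nu$ on $\mathscr{P}$ is central if for every vertex $v$ and every positive integer $n$, $\nu$ takes the same value on all paths of length $n$ leading from $0$ to $v$. A central measure is ergodic if it is an extreme point of the convex compact set of central measures. The absolute $\mathscr{A}_S(G)$ is the set of all ergodic central measures, with the topology induced by the weak topology on Borel probability measures on $\mathscr{P}$. The main part of the absolute is the subset of nondegenerate measures, i.e. those ergodic central measures for which every finite path starting at $0$ has nonzero measure. The rank of a commutative group $G$ is $\dim_{\mathbb{Q}}(G\otimes\mathbb{Q})$. The $0$-dimensional closed disk is a point and equals its own interior. *)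

theory Defs
  imports "HOL-Probability.Probability" "HOL-Library.Poly_Mapping"
begin

section \<open>The rank of a commutative group\<close>

text \<open>The tensor product of a commutative group with the rationals is the free abelian group on
  pairs \<open>(g, q)\<close> modulo the subgroup generated by the biadditivity relations.\<close>

inductive_set biadditive_relations :: "('a::ab_group_add \<times> rat \<Rightarrow>\<^sub>0 int) set" where
  add_left: "frag_of (g + h, q) - frag_of (g, q) - frag_of (h, q) \<in> biadditive_relations"
| add_right: "frag_of (g, p + q) - frag_of (g, p) - frag_of (g, q) \<in> biadditive_relations"
| diff: "x \<in> biadditive_relations \<Longrightarrow> y \<in> biadditive_relations \<Longrightarrow> x - y \<in> biadditive_relations"

lemma biadditive_relations_zero: "0 \<in> biadditive_relations"
  using biadditive_relations.diff[OF biadditive_relations.add_left biadditive_relations.add_left]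
  by (metis diff_self)

lemma biadditive_relations_uminus:
  "x \<in> biadditive_relations \<Longrightarrow> - x \<in> biadditive_relations"
  using biadditive_relations.diff[OF biadditive_relations_zero] by fastforce

lemma biadditive_relations_add:
  "x \<in> biadditive_relations \<Longrightarrow> y \<in> biadditive_relations \<Longrightarrow> x + y \<in> biadditive_relations"
  using biadditive_relations.diff[OF _ biadditive_relations_uminus] by fastforce

definition tensor_rel ::
  "('a::ab_group_add \<times> rat \<Rightarrow>\<^sub>0 int) \<Rightarrow> ('a \<times> rat \<Rightarrow>\<^sub>0 int) \<Rightarrow> bool" where
  "tensor_rel x y \<longleftrightarrow> x - y \<in> biadditive_relations"

lemma equivp_tensor_rel: "equivp tensor_rel"
proof (rule equivpI)
  show "reflp tensor_rel"
    by (simp add: reflp_def tensor_rel_def biadditive_relations_zero)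
  show "symp tensor_rel"
    unfolding symp_def tensor_rel_def
    by (metis biadditive_relations_uminus minus_diff_eq)
  show "transp tensor_rel"
    unfolding transp_def tensor_rel_def
    using biadditive_relations_add by fastforce
qed

quotient_type (overloaded) 'a rat_tensor = "'a::ab_group_add \<times> rat \<Rightarrow>\<^sub>0 int" / tensor_rel
  by (rule equivp_tensor_rel)

instantiation rat_tensor :: (ab_group_add) ab_group_add
begin

lift_definition zero_rat_tensor :: "'a rat_tensor" is 0 .

lift_definition plus_rat_tensor :: "'a rat_tensor \<Rightarrow> 'a rat_tensor \<Rightarrow> 'a rat_tensor" is "(+)"
  unfolding tensor_rel_def by (simp add: add_diff_add biadditive_relations_add)

lift_definition uminus_rat_tensor :: "'a rat_tensor \<Rightarrow> 'a rat_tensor" is uminus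
  unfolding tensor_rel_def
  by (simp only: minus_diff_minus biadditive_relations_uminus)

lift_definition minus_rat_tensor :: "'a rat_tensor \<Rightarrow> 'a rat_tensor \<Rightarrow> 'a rat_tensor" is "(-)"
proof -
  fix x x' y y' :: "'a \<times> rat \<Rightarrow>\<^sub>0 int"
  assume "tensor_rel x x'" "tensor_rel y y'"
  then have "(x - x') - (y - y') \<in> biadditive_relations"
    unfolding tensor_rel_def by (rule biadditive_relations.diff)
  moreover have "(x - x') - (y - y') = (x - y) - (x' - y')"
    by simp
  ultimately show "tensor_rel (x - y) (x' - y')"
    unfolding tensor_rel_def by simp
qed

instance
proof
  fix a b c :: "'a rat_tensor"
  show "a + b + c = a + (b + c)"
    by transfer (simp add: tensor_rel_def add.assoc biadditive_relations_zero)
  show "a + b = b + a"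
    by transfer (simp add: tensor_rel_def add.commute biadditive_relations_zero)
  show "0 + a = a"
    by transfer (simp add: tensor_rel_def biadditive_relations_zero)
  show "- a + a = 0"
    by transfer (simp add: tensor_rel_def biadditive_relations_zero)
  show "a - b = a + - b"
    by transfer (simp add: tensor_rel_def biadditive_relations_zero)
qed

end

definition frag_scale ::
  "rat \<Rightarrow> ('a \<times> rat \<Rightarrow>\<^sub>0 int) \<Rightarrow> ('a \<times> rat \<Rightarrow>\<^sub>0 int)" where
  "frag_scale r = frag_extend (\<lambda>(g, q). frag_of (g, r * q))"

lemma frag_scale_of [simp]: "frag_scale r (frag_of (g, q)) = frag_of (g, r * q)"
  by (simp add: frag_scale_def)

lemma frag_scale_diff [simp]: "frag_scale r (x - y) = frag_scale r x - frag_scale r y"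
  by (simp add: frag_scale_def frag_extend_diff)

lemma frag_scale_add [simp]: "frag_scale r (x + y) = frag_scale r x + frag_scale r y"
  by (simp add: frag_scale_def frag_extend_add)

lemma frag_scale_zero [simp]: "frag_scale r 0 = 0"
  by (simp add: frag_scale_def)

lemma frag_scale_relations:
  "x \<in> biadditive_relations \<Longrightarrow> frag_scale r x \<in> biadditive_relations"
  by (induction rule: biadditive_relations.induct)
    (auto simp: distrib_left intro: biadditive_relations.intros)

text \<open>The rational scalar multiplication \<open>r \<cdot> (g \<otimes> q) = g \<otimes> (r q)\<close>.\<close>

lift_definition rat_tensor_scale :: "rat \<Rightarrow> 'a::ab_group_add rat_tensor \<Rightarrow> 'a rat_tensor"
  is frag_scale
  unfolding tensor_rel_def by (metis frag_scale_relations frag_scale_diff)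

lemma frag_scale_add_left:
  "frag_scale (a + b) x - (frag_scale a x + frag_scale b x) \<in> biadditive_relations"
  using subset_UNIV[of "Poly_Mapping.keys x"]
proof (induction x rule: frag_induction)
  case zero
  show ?case by (simp add: biadditive_relations_zero)
next
  case (one x)
  obtain g q where "x = (g, q)" by fastforce
  then show ?case
    using biadditive_relations.add_right[of g "a * q" "b * q"]
    by (simp add: distrib_right diff_diff_eq)
next
  case (diff x y)
  have "frag_scale (a + b) (x - y) - (frag_scale a (x - y) + frag_scale b (x - y)) =
    (frag_scale (a + b) x - (frag_scale a x + frag_scale b x)) -
    (frag_scale (a + b) y - (frag_scale a y + frag_scale b y))"
    by simp
  then show ?case
    using biadditive_relations.diff[OF diff] by (simp only:)
qed

lemma frag_scale_mult: "frag_scale a (frag_scale b x) = frag_scale (a * b) x"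
  using subset_UNIV[of "Poly_Mapping.keys x"]
  by (induction x rule: frag_induction) (auto simp: mult.assoc)

lemma frag_scale_one: "frag_scale 1 x = x"
  using subset_UNIV[of "Poly_Mapping.keys x"]
  by (induction x rule: frag_induction) auto

interpretation rat_tensor: vector_space rat_tensor_scale
proof
  fix a b :: rat and x y :: "'a rat_tensor"
  show "rat_tensor_scale a (x + y) = rat_tensor_scale a x + rat_tensor_scale a y"
    by transfer (simp add: tensor_rel_def biadditive_relations_zero)
  show "rat_tensor_scale (a + b) x = rat_tensor_scale a x + rat_tensor_scale b x"
    by transfer (simp add: tensor_rel_def frag_scale_add_left)
  show "rat_tensor_scale a (rat_tensor_scale b x) = rat_tensor_scale (a * b) x"
    by transfer (simp add: tensor_rel_def frag_scale_mult biadditive_relations_zero)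
  show "rat_tensor_scale 1 x = x"
    by transfer (simp add: tensor_rel_def frag_scale_one biadditive_relations_zero)
qed

definition group_rank :: "'a::ab_group_add itself \<Rightarrow> nat" where
  "group_rank _ = rat_tensor.dim (UNIV :: 'a rat_tensor set)"

section \<open>Systems of generators and paths in the Cayley graph\<close>

text \<open>A finite nonempty system of elements is a family \<open>S\<close> indexed by a finite type. Allowing the
  empty list below makes no difference: \<open>0\<close> is also the sum of the nonempty sequence consisting of
  \<open>S i\<close> followed by any sequence of members of the system with sum \<open>- S i\<close>.\<close>

definition semigroup_generators :: "('s::finite \<Rightarrow> 'a::ab_group_add) \<Rightarrow> bool" where
  "semigroup_generators S \<longleftrightarrow> (\<forall>g. \<exists>xs. g = sum_list (map S xs))"

text \<open>The end of the path in the Cayley graph that starts at \<open>g\<close> and has the given edge marks; the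
  edge marked \<open>i\<close> leads from \<open>g\<close> to \<open>g + S i\<close>.\<close>

primrec path_end :: "('s \<Rightarrow> 'a::ab_group_add) \<Rightarrow> 'a \<Rightarrow> 's list \<Rightarrow> 'a" where
  "path_end S g [] = g"
| "path_end S g (i # is) = path_end S (g + S i) is"

text \<open>Infinite paths from \<open>0\<close> are identified with their sequences of edge marks.\<close>

definition path_topology :: "(nat \<Rightarrow> 's) topology" where
  "path_topology = product_topology (\<lambda>_. discrete_topology UNIV) UNIV"

definition path_borel :: "(nat \<Rightarrow> 's) measure" where
  "path_borel = sigma UNIV {U. openin path_topology U}"

definition cylinder :: "'s list \<Rightarrow> (nat \<Rightarrow> 's) set" where
  "cylinder xs = {\<omega>. \<forall>k<length xs. \<omega> k = xs ! k}"

section \<open>The absolute\<close>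

definition path_probabilities :: "(nat \<Rightarrow> 's) measure set" where
  "path_probabilities = {\<nu>. prob_space \<nu> \<and> sets \<nu> = sets path_borel}"

definition central_measures :: "('s \<Rightarrow> 'a::ab_group_add) \<Rightarrow> (nat \<Rightarrow> 's) measure set" where
  "central_measures S = {\<nu> \<in> path_probabilities.
     \<forall>v. \<forall>n>0. \<forall>xs ys.
       length xs = n \<and> path_end S 0 xs = v \<and> length ys = n \<and> path_end S 0 ys = v \<longrightarrow>
       measure \<nu> (cylinder xs) = measure \<nu> (cylinder ys)}"

text \<open>Extreme points of a set of measures. The library notion \<open>extreme_point_of\<close> requires a real
  vector space, which the type of measures is not, so the convex combination is written out.\<close>

definition extreme_measure :: "'b measure \<Rightarrow> 'b measure set \<Rightarrow> bool" where
  "extreme_measure \<nu> C \<longleftrightarrow> \<nu> \<in> C \<and>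
     (\<forall>\<mu>\<^sub>1\<in>C. \<forall>\<mu>\<^sub>2\<in>C. \<forall>t. 0 < t \<and> t < 1 \<and>
        (\<forall>A\<in>sets \<nu>. measure \<nu> A = (1 - t) * measure \<mu>\<^sub>1 A + t * measure \<mu>\<^sub>2 A) \<longrightarrow> \<mu>\<^sub>1 = \<mu>\<^sub>2)"

definition absolute :: "('s \<Rightarrow> 'a::ab_group_add) \<Rightarrow> (nat \<Rightarrow> 's) measure set" where
  "absolute S = {\<nu>. extreme_measure \<nu> (central_measures S)}"

definition absolute_main_part :: "('s \<Rightarrow> 'a::ab_group_add) \<Rightarrow> (nat \<Rightarrow> 's) measure set" where
  "absolute_main_part S = {\<nu> \<in> absolute S. \<forall>xs. measure \<nu> (cylinder xs) \<noteq> 0}"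

text \<open>The coarsest topology on the Borel probability measures for which integration of every
  bounded continuous function is continuous.\<close>

definition weak_topology :: "(nat \<Rightarrow> 's) measure topology" where
  "weak_topology = topology_generated_by
     {{\<nu> \<in> path_probabilities. (\<integral>\<omega>. f \<omega> \<partial>\<nu>) \<in> U} | f U.
        continuous_map path_topology euclideanreal f \<and> bounded (range f) \<and> open U}"

definition absolute_topology :: "('s \<Rightarrow> 'a::ab_group_add) \<Rightarrow> (nat \<Rightarrow> 's) measure topology" where
  "absolute_topology S = subtopology weak_topology (absolute S)"

section \<open>The closed disk\<close>

text \<open>As a subset of \<open>Euclidean_space d\<close>, whose points are the real sequences supported on the
  first \<open>d\<close> coordinates; the dimension must be a term because it is the rank of the group.\<close>

definition closed_disk :: "nat \<Rightarrow> (nat \<Rightarrow> real) set" where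
  "closed_disk d = {x \<in> topspace (Euclidean_space d). sqrt (\<Sum>i<d. (x i)\<^sup>2) \<le> 1}"

end

theory Submission
  imports Defs
begin

text \<open>Let \<open>L\<close> be the space of vectors \<open>(f (S s))\<^sub>s\<close> with \<open>f\<close> an additive map to the reals; its
  dimension is the rank of the group. Conditioning an ergodic central measure on its first letter
  shows that it is a Bernoulli measure, with letter weights \<open>p\<close> whose product along a word depends
  only on the length and the sum of the word. Conversely all such Bernoulli measures are ergodic:
  a central measure gives a doubled word at least the square of the probability of the word.

  The orthogonal projection to \<open>L\<close> (the moment map of the exponential family of these weights) maps
  them homeomorphically onto the projection of the simplex, a polytope spanning \<open>L\<close>: the entropy
  maximiser in each fibre of the simplex is such a weight vector, and two such vectors in the same
  fibre are equal because real relations between the generators can be replaced by integer ones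
  with the same signs. Under this map the positive weights, that is the nondegenerate measures,
  correspond to the relative interior of the polytope.\<close>

section \<open>Homomorphisms out of the tensor product with the rationals\<close>

text \<open>The obstacle is the boundary: a central weight may vanish on some letters, where
  logarithms and the exponential formula fail. Uniqueness in a fibre is therefore a comparison of
  monomials instead of strict concavity of the entropy, and existence moves the maximiser slightly,
  so that the letters of both words have positive weight before logarithms are taken.

  Real relations can be made integral because \<open>L\<close> is spanned by rational vectors: the
  coordinates of g tensor 1 in a basis taken from the generators are rational. An integer vector
  killed by these coordinates is a relation in the group only up to torsion; repeating both words
  removes the torsion and keeps the letters that occur.

  Generation as a semigroup yields a nonempty word with sum 0, whose letter frequencies project to
  0. So the polytope contains 0 and its affine hull is all of \<open>L\<close>. For the integers
  with the single element 1, which generates only as a group, the polytope would be a point although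
  the rank is 1.\<close>

definition nat_mult :: "nat \<Rightarrow> 'a::ab_group_add \<Rightarrow> 'a" where
  "nat_mult n x = ((+) x ^^ n) 0"

text \<open>At least one of the two terms is 0. The difference avoids a case distinction on the sign
  and turns additivity in \<open>k\<close> into a cancellation of natural multiples.\<close>

definition int_mult :: "int \<Rightarrow> 'a::ab_group_add \<Rightarrow> 'a" where
  "int_mult k x = nat_mult (nat k) x - nat_mult (nat (- k)) x"

lemma nat_mult_0 [simp]: "nat_mult 0 x = 0"
  and nat_mult_Suc [simp]: "nat_mult (Suc n) x = x + nat_mult n x"
  by (simp_all add: nat_mult_def)

lemma nat_mult_add_left: "nat_mult (m + n) x = nat_mult m x + nat_mult n x"
  by (induction m) (simp_all add: add.assoc)

lemma nat_mult_add_right: "nat_mult n (x + y) = nat_mult n x + nat_mult n y"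
  by (induction n) (simp_all add: algebra_simps)

lemma int_mult_add_left: "int_mult (a + b) x = int_mult a x + int_mult b x"
proof -
  have "nat (a + b) + (nat (- a) + nat (- b)) = nat (- (a + b)) + (nat a + nat b)"
    by auto
  then have "nat_mult (nat (a + b)) x + (nat_mult (nat (- a)) x + nat_mult (nat (- b)) x) =
      nat_mult (nat (- (a + b))) x + (nat_mult (nat a) x + nat_mult (nat b) x)"
    by (simp only: nat_mult_add_left [symmetric])
  then show ?thesis
    by (simp add: int_mult_def algebra_simps)
qed

lemma int_mult_add_right: "int_mult k (x + y) = int_mult k x + int_mult k y"
  by (simp add: int_mult_def nat_mult_add_right)

lemma int_mult_0 [simp]: "int_mult 0 x = 0"
  by (simp add: int_mult_def)

lemma int_mult_1 [simp]: "int_mult 1 x = x"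
  by (simp add: int_mult_def)

lemma int_mult_diff_left: "int_mult (a - b) x = int_mult a x - int_mult b x"
  using int_mult_add_left[of "a - b" b x] by simp

lemma int_mult_of_nat [simp]: "int_mult (int n) x = nat_mult n x"
  by (simp add: int_mult_def)

text \<open>The homomorphism out of the free abelian group given by its universal property. The
  target is an arbitrary group, since both the group itself and the reals occur below.\<close>

definition frag_eval :: "('k \<Rightarrow> 'b::ab_group_add) \<Rightarrow> ('k \<Rightarrow>\<^sub>0 int) \<Rightarrow> 'b" where
  "frag_eval f z = (\<Sum>k\<in>Poly_Mapping.keys z. int_mult (Poly_Mapping.lookup z k) (f k))"

lemma frag_eval_superset:
  assumes "finite K" "Poly_Mapping.keys z \<subseteq> K"
  shows "frag_eval f z = (\<Sum>k\<in>K. int_mult (Poly_Mapping.lookup z k) (f k))"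
  unfolding frag_eval_def using assms
  by (intro sum.mono_neutral_left) (auto simp: in_keys_iff)

lemma frag_eval_diff [simp]: "frag_eval f (x - y) = frag_eval f x - frag_eval f y"
proof -
  let ?K = "Poly_Mapping.keys x \<union> Poly_Mapping.keys y"
  have "Poly_Mapping.keys (x - y) \<subseteq> ?K"
    by (auto simp: in_keys_iff lookup_minus)
  then show ?thesis
    by (simp add: frag_eval_superset[of ?K] lookup_minus int_mult_diff_left sum_subtractf)
qed

lemma frag_eval_of [simp]: "frag_eval f (frag_of k) = f k"
  by (simp add: frag_eval_def)

lemma frag_eval_0 [simp]: "frag_eval f 0 = 0"
  by (simp add: frag_eval_def)

lemma frag_eval_add [simp]: "frag_eval f (x + y) = frag_eval f x + frag_eval f y"
  using frag_eval_diff[of f "x + y" y] by (simp del: frag_eval_diff)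

lemma rat_denominator: "\<exists>N>0. of_nat N * (q::rat) \<in> \<int>"
proof -
  obtain a b where ab: "quotient_of q = (a, b)" by fastforce
  then have b: "b > 0" and q: "q = of_int a / of_int b"
    by (auto intro: quotient_of_denom_pos quotient_of_div)
  then have "of_nat (nat b) * q = of_int a"
    by (simp add: of_nat_nat)
  with b show ?thesis
    by (intro exI[of _ "nat b"]) auto
qed

lemma Ints_of_nat_dvd_mult:
  assumes "of_nat N * (q::rat) \<in> \<int>" "N dvd M"
  shows "of_nat M * q \<in> \<int>"
proof -
  obtain k where "M = k * N" using assms(2) by (metis dvd_def mult.commute)
  then have "of_nat M * q = of_nat k * (of_nat N * q)" by simp
  then show ?thesis using assms(1) by (metis Ints_mult Ints_of_nat)
qed

text \<open>Clearing denominators turns a relation into an identity in the group itself.\<close>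

lemma biadditive_relations_clear_denominators:
  assumes "z \<in> biadditive_relations"
  shows "\<exists>N>0. \<forall>M. N dvd M \<longrightarrow>
    frag_eval (\<lambda>(g, q). int_mult \<lfloor>of_nat M * q\<rfloor> g) z = (0 :: 'a::ab_group_add)"
  using assms
proof (induction rule: biadditive_relations.induct)
  case (add_left g h q)
  show ?case by (intro exI[of _ 1]) (simp add: int_mult_add_right)
next
  case (add_right g p q)
  obtain N1 N2 where N: "N1 > 0" "of_nat N1 * p \<in> \<int>" "N2 > 0" "of_nat N2 * q \<in> \<int>"
    using rat_denominator by metis
  show ?case
  proof (intro exI[of _ "N1 * N2"] conjI allI impI)
    fix M assume M: "N1 * N2 dvd M"
    have "of_nat M * p \<in> \<int>" "of_nat M * q \<in> \<int>"
      using N M by (meson Ints_of_nat_dvd_mult dvd_mult_left dvd_mult_right)+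
    \<comment> \<open>The floor only names an integer: \<open>M\<close> clears both denominators, so
      nothing is rounded and additivity is exact.\<close>
    then have "\<lfloor>of_nat M * (p + q)\<rfloor> = \<lfloor>of_nat M * p\<rfloor> + \<lfloor>of_nat M * q\<rfloor>"
      by (auto simp: distrib_left elim!: Ints_cases)
    then show "frag_eval (\<lambda>(g, q). int_mult \<lfloor>of_nat M * q\<rfloor> g)
        (frag_of (g, p + q) - frag_of (g, p) - frag_of (g, q)) = (0::'a)"
      by (simp add: int_mult_add_left)
  qed (use N in simp)
next
  case (diff x y)
  then obtain N1 N2 where N: "N1 > 0" "N2 > 0"
    "\<forall>M. N1 dvd M \<longrightarrow> frag_eval (\<lambda>(g, q). int_mult \<lfloor>of_nat M * q\<rfloor> g) x = (0::'a)"
    "\<forall>M. N2 dvd M \<longrightarrow> frag_eval (\<lambda>(g, q). int_mult \<lfloor>of_nat M * q\<rfloor> g) y = (0::'a)"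
    by blast
  \<comment> \<open>Since each claim holds for all multiples of its \<open>N\<close>, the product
    serves both relations at once.\<close>
  show ?case
  proof (intro exI[of _ "N1 * N2"] conjI allI impI)
    fix M assume "N1 * N2 dvd M"
    then have "N1 dvd M" "N2 dvd M"
      by (auto elim: dvd_mult_left dvd_mult_right)
    with N show "frag_eval (\<lambda>(g, q). int_mult \<lfloor>of_nat M * q\<rfloor> g) (x - y) = (0::'a)"
      by simp
  qed (use N in simp)
qed

definition tens :: "'a::ab_group_add \<Rightarrow> 'a rat_tensor" where
  "tens g = abs_rat_tensor (frag_of (g, 1))"

lemma abs_rat_tensor_eq_0_iff: "abs_rat_tensor x = 0 \<longleftrightarrow> x \<in> biadditive_relations"
  by (simp add: zero_rat_tensor_def rat_tensor.abs_eq_iff tensor_rel_def)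

lemma abs_rat_tensor_diff: "abs_rat_tensor (x - y) = abs_rat_tensor x - abs_rat_tensor y"
  by (simp add: minus_rat_tensor.abs_eq)

lemma additive_tens: "Modules.additive (tens :: 'a::ab_group_add \<Rightarrow> 'a rat_tensor)"
proof
  fix g h :: 'a
  have "abs_rat_tensor (frag_of (g + h, 1) - frag_of (g, 1) - frag_of (h, 1)) = 0"
    by (simp add: abs_rat_tensor_eq_0_iff biadditive_relations.add_left)
  then show "tens (g + h) = tens g + tens h"
    by (simp add: abs_rat_tensor_diff tens_def diff_diff_eq plus_rat_tensor.abs_eq)
qed

text \<open>Evaluating the cleared relation at \<open>M = N\<close> leaves exactly
  \<open>nat_mult N g\<close>. This controls what is lost when words are compared through their
  rational coordinates.\<close>

lemma tens_eq_0_imp_torsion: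
  assumes "tens (g::'a::ab_group_add) = 0"
  shows "\<exists>N>0. nat_mult N g = 0"
proof -
  have "frag_of (g, 1 :: rat) \<in> biadditive_relations"
    using assms by (simp add: tens_def abs_rat_tensor_eq_0_iff)
  from biadditive_relations_clear_denominators[OF this]
  obtain N where N: "N > 0" "\<forall>M. N dvd M \<longrightarrow>
      frag_eval (\<lambda>(g, q). int_mult \<lfloor>of_nat M * q\<rfloor> g) (frag_of (g, 1 :: rat)) = 0"
    by blast
  from N(2)[rule_format, of N] N(1) show ?thesis
    by (intro exI[of _ N]) simp
qed

lemma rat_tensor_scale_tens: "rat_tensor_scale q (tens g) = abs_rat_tensor (frag_of (g, q))"
  by (simp add: tens_def rat_tensor_scale.abs_eq)

text \<open>The map sending \<open>(g, q)\<close> to \<open>q * \<psi> g\<close> is biadditive, so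
  its extension to the free group kills the relations and descends. It carries basis expansions in
  the tensor product over to real characters.\<close>

lemma additive_extends_to_tensor:
  fixes \<psi> :: "'a::ab_group_add \<Rightarrow> real"
  assumes "Modules.additive \<psi>"
  obtains \<phi> :: "'a rat_tensor \<Rightarrow> real" where "Modules.additive \<phi>"
    "\<And>q v. \<phi> (rat_tensor_scale q v) = of_rat q * \<phi> v" "\<And>g. \<phi> (tens g) = \<psi> g"
proof -
  define \<beta> where "\<beta> = (\<lambda>(g, q). of_rat q * \<psi> g)"
  have rel: "frag_eval \<beta> z = 0" if "z \<in> biadditive_relations" for z
    using that by induction (auto simp: \<beta>_def of_rat_add Modules.additive.add[OF assms] algebra_simps)
  define \<phi> where "\<phi> v = frag_eval \<beta> (rep_rat_tensor v)" for v
  have \<phi>: "\<phi> (abs_rat_tensor z) = frag_eval \<beta> z" for z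
  proof -
    have "tensor_rel (rep_rat_tensor (abs_rat_tensor z)) z"
      by (simp add: rat_tensor.abs_eq_iff [symmetric] Quotient3_abs_rep[OF Quotient3_rat_tensor])
    then show ?thesis
      using rel unfolding \<phi>_def tensor_rel_def by fastforce
  qed
  have ex: "\<exists>z. v = abs_rat_tensor z" for v :: "'a rat_tensor"
    by (metis Quotient3_abs_rep[OF Quotient3_rat_tensor])
  have scale: "frag_eval \<beta> (frag_scale q z) = of_rat q * frag_eval \<beta> z" for q z
    using subset_UNIV[of "Poly_Mapping.keys z"]
    by (induction z rule: frag_induction) (auto simp: \<beta>_def of_rat_mult algebra_simps)
  show thesis
  proof
    show "Modules.additive \<phi>"
    proof
      fix v w
      show "\<phi> (v + w) = \<phi> v + \<phi> w"
        using ex[of v] ex[of w] by (auto simp: \<phi> plus_rat_tensor.abs_eq)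
    qed
    show "\<phi> (rat_tensor_scale q v) = of_rat q * \<phi> v" for q v
      using ex[of v] by (auto simp: \<phi> rat_tensor_scale.abs_eq scale)
    show "\<phi> (tens g) = \<psi> g" for g
      by (simp add: tens_def \<phi>) (simp add: \<beta>_def)
  qed
qed

section \<open>Characters and relations between words\<close>

lemma span_tens_generators:
  fixes S :: "'s::finite \<Rightarrow> 'a::ab_group_add"
  assumes "semigroup_generators S"
  shows "rat_tensor.span (range (\<lambda>s. tens (S s))) = UNIV"
proof -
  interpret additive "tens :: 'a \<Rightarrow> _" by (rule additive_tens)
  have tens: "tens g \<in> rat_tensor.span (range (\<lambda>s. tens (S s)))" for g
  proof -
    obtain xs where g: "g = sum_list (map S xs)"
      using assms unfolding semigroup_generators_def by blast
    show ?thesis unfolding g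
      by (induction xs)
        (auto simp: zero add rat_tensor.span_zero intro: rat_tensor.span_add rat_tensor.span_base)
  qed
  have "abs_rat_tensor z \<in> rat_tensor.span (range (\<lambda>s. tens (S s)))" for z
    using subset_UNIV[of "Poly_Mapping.keys z"]
  proof (induction z rule: frag_induction)
    case zero
    show ?case by (metis rat_tensor.span_zero zero_rat_tensor_def)
  next
    case (one x)
    show ?case
      using tens rat_tensor.span_scale rat_tensor_scale_tens by (metis surj_pair)
  next
    case (diff x y)
    then show ?case by (simp add: abs_rat_tensor_diff rat_tensor.span_diff)
  qed
  then show ?thesis
    by (metis Quotient3_abs_rep[OF Quotient3_rat_tensor] UNIV_eq_I)
qed

text \<open>A basis of the tensor product can be chosen among the images of the generators, and
  \<open>c i\<close> is the coefficient at \<open>S i\<close>. A character is thus determined by its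
  values on the generators in \<open>I\<close>, with rational coefficients independent of the
  character.\<close>

lemma tensor_coordinates:
  fixes S :: "'s::finite \<Rightarrow> 'a::ab_group_add"
  assumes "semigroup_generators S"
  obtains I :: "'s set" and c :: "'s \<Rightarrow> 'a \<Rightarrow> rat" where
    "card I = group_rank TYPE('a)"
    "\<forall>i. Modules.additive (\<lambda>g. real_of_rat (c i g))"
    "\<forall>i\<in>I. \<forall>j\<in>I. c i (S j) = of_bool (i = j)"
    "\<forall>f g. Modules.additive f \<longrightarrow> f g = (\<Sum>i\<in>I. real_of_rat (c i g) * f (S i))"
    "\<forall>g. (\<forall>i\<in>I. c i g = 0) \<longrightarrow> (\<exists>N>0. nat_mult N g = 0)"
proof -
  obtain B where B: "B \<subseteq> range (\<lambda>s. tens (S s))" "\<not> rat_tensor.dependent B"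
    "range (\<lambda>s. tens (S s)) \<subseteq> rat_tensor.span B"
    using rat_tensor.maximal_independent_subset by blast
  have span: "rat_tensor.span B = UNIV"
    using span_tens_generators[OF assms] rat_tensor.span_mono[OF B(3)]
    by (auto simp: rat_tensor.span_span)
  obtain I where I: "inj_on (\<lambda>s. tens (S s)) I" "B = (\<lambda>s. tens (S s)) ` I"
    using B(1) by (meson subset_image_inj)
  have fin: "finite B" using I(2) by simp
  define c where "c i g = rat_tensor.representation B (tens g) (tens (S i))" for i g
  have expand: "tens g = (\<Sum>i\<in>I. rat_tensor_scale (c i g) (tens (S i)))" for g
  proof -
    have "tens g = (\<Sum>b\<in>B. rat_tensor_scale (rat_tensor.representation B (tens g) b) b)"
      using B(2) fin by (subst rat_tensor.sum_representation_eq) (auto simp: span)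
    then show ?thesis
      using I by (simp add: sum.reindex c_def)
  qed
  show thesis
  proof (rule that[of I c]; (intro allI ballI impI)?)
    have "card I = card B" using I by (simp add: card_image)
    also have "\<dots> = group_rank TYPE('a)"
      unfolding group_rank_def using B(2) span
      by (metis rat_tensor.dim_eq_card rat_tensor.span_UNIV)
    finally show "card I = group_rank TYPE('a)" .
    show "Modules.additive (\<lambda>g. real_of_rat (c i g))" for i
      by standard (simp add: c_def Modules.additive.add[OF additive_tens]
        rat_tensor.representation_add B(2) span of_rat_add)
    show "c i (S j) = of_bool (i = j)" if "i \<in> I" "j \<in> I" for i j
      using that I(1) B(2) by (auto simp: c_def rat_tensor.representation_basis I(2) inj_on_def)
    show "f g = (\<Sum>i\<in>I. real_of_rat (c i g) * f (S i))" if f: "Modules.additive f" for f g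
    proof -
      obtain \<phi> :: "'a rat_tensor \<Rightarrow> real" where \<phi>: "Modules.additive \<phi>"
        "\<And>q v. \<phi> (rat_tensor_scale q v) = of_rat q * \<phi> v" "\<And>g. \<phi> (tens g) = f g"
        using additive_extends_to_tensor[OF f] by blast
      have "f g = \<phi> (\<Sum>i\<in>I. rat_tensor_scale (c i g) (tens (S i)))"
        by (simp only: \<phi>(3) expand[symmetric])
      then show ?thesis
        by (simp add: Modules.additive.sum[OF \<phi>(1)] \<phi>)
    qed
    show "\<exists>N>0. nat_mult N g = 0" if "\<forall>i\<in>I. c i g = 0" for g
      using expand[of g] that by (intro tens_eq_0_imp_torsion) simp
  qed
qed

definition character_space :: "('s::finite \<Rightarrow> 'a::ab_group_add) \<Rightarrow> (real ^ 's) set" where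
  "character_space S = {a. \<exists>f. Modules.additive f \<and> (\<forall>s. a $ s = f (S s))}"

lemma subspace_character_space: "subspace (character_space S)"
proof (rule subspaceI)
  show "0 \<in> character_space S"
    unfolding character_space_def
    by (auto intro!: exI[of _ "\<lambda>_. 0"] simp: Modules.additive_def)
  show "x + y \<in> character_space S" if "x \<in> character_space S" "y \<in> character_space S" for x y
  proof -
    from that obtain f h where "Modules.additive f" "\<forall>s. x $ s = f (S s)"
      "Modules.additive h" "\<forall>s. y $ s = h (S s)" unfolding character_space_def by blast
    then show ?thesis
      unfolding character_space_def
      by (auto intro!: exI[of _ "\<lambda>g. f g + h g"] simp: Modules.additive_def)
  qed
  show "k *\<^sub>R x \<in> character_space S" if "x \<in> character_space S" for k x
  proof -
    from that obtain f where "Modules.additive f" "\<forall>s. x $ s = f (S s)"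
      unfolding character_space_def by blast
    then show ?thesis
      unfolding character_space_def
      by (auto intro!: exI[of _ "\<lambda>g. k * f g"] simp: Modules.additive_def algebra_simps)
  qed
qed

text \<open>The coordinate functions are themselves characters. Their vectors \<open>u i\<close>
  span, with coefficients \<open>f (S i)\<close>, and are independent because on the positions in
  \<open>I\<close> they restrict to unit vectors.\<close>

lemma dim_character_space:
  fixes S :: "'s::finite \<Rightarrow> 'a::ab_group_add"
  assumes "semigroup_generators S"
  shows "dim (character_space S) = group_rank TYPE('a)"
proof -
  obtain I and c :: "'s \<Rightarrow> 'a \<Rightarrow> rat" where card: "card I = group_rank TYPE('a)" and
    add: "\<forall>i. Modules.additive (\<lambda>g. real_of_rat (c i g))" and
    dual: "\<forall>i\<in>I. \<forall>j\<in>I. c i (S j) = of_bool (i = j)" and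
    expand: "\<forall>f g. Modules.additive f \<longrightarrow> f g = (\<Sum>i\<in>I. real_of_rat (c i g) * f (S i))" and
    torsion: "\<forall>g. (\<forall>i\<in>I. c i g = 0) \<longrightarrow> (\<exists>N>0. nat_mult N g = 0)"
    using tensor_coordinates[OF assms(1)] .
  note add = add[rule_format] and dual = dual[rule_format] and expand = expand[rule_format]
    and torsion = torsion[rule_format]
  define u :: "'s \<Rightarrow> real ^ 's" where "u i = (\<chi> s. real_of_rat (c i (S s)))" for i
  have u: "u i $ j = of_bool (i = j)" if "i \<in> I" "j \<in> I" for i j
    using dual[OF that] by (simp add: u_def)
  have inj: "inj_on u I"
    by (rule inj_onI) (metis (full_types) of_bool_eq_iff u)
  show ?thesis
  proof (rule dim_unique)
    show "u ` I \<subseteq> character_space S"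
      using add unfolding character_space_def u_def by fastforce
    show "character_space S \<subseteq> span (u ` I)"
    proof
      fix a assume "a \<in> character_space S"
      then obtain f where f: "Modules.additive f" "\<And>s. a $ s = f (S s)"
        unfolding character_space_def by blast
      have "a = (\<Sum>i\<in>I. f (S i) *\<^sub>R u i)"
      proof (rule iffD2[OF vec_eq_iff], rule allI)
        fix s
        show "a $ s = (\<Sum>i\<in>I. f (S i) *\<^sub>R u i) $ s"
          unfolding f(2) by (subst expand[OF f(1)]) (simp add: u_def mult.commute)
      qed
      then show "a \<in> span (u ` I)"
        by (simp add: span_base span_scale span_sum)
    qed
    show "independent (u ` I)"
      unfolding independent_explicit
    proof (intro conjI allI impI ballI)
      fix k v assume "(\<Sum>v\<in>u ` I. k v *\<^sub>R v) = 0" "v \<in> u ` I"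
      then obtain j where j: "j \<in> I" "v = u j" and "(\<Sum>i\<in>I. k (u i) *\<^sub>R u i) = 0"
        using inj by (auto simp: sum.reindex)
      then have "0 = (\<Sum>i\<in>I. k (u i) *\<^sub>R u i) $ j" by simp
      also have "\<dots> = (\<Sum>i\<in>I. if i = j then k (u i) else 0)"
        using j by (auto simp: u intro!: sum.cong)
      finally show "k v = 0" using j by simp
    qed simp
    show "card (u ` I) = group_rank TYPE('a)"
      using inj card by (simp add: card_image)
  qed
qed

text \<open>By simultaneous Diophantine approximation: an integer vector close enough to a multiple of
  \<open>u\<close> satisfies every integer relation up to an error less than one, hence exactly.\<close>

lemma integer_vector_same_signs:
  fixes u :: "'s::finite \<Rightarrow> real" and C :: "('s \<Rightarrow> int) set"
  assumes "finite C" and C: "\<And>c. c \<in> C \<Longrightarrow> (\<Sum>s\<in>UNIV. of_int (c s) * u s) = 0"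
  obtains n :: "'s \<Rightarrow> int" where "\<And>s. n s > 0 \<longleftrightarrow> u s > 0" "\<And>s. n s < 0 \<longleftrightarrow> u s < 0"
    "\<And>c. c \<in> C \<Longrightarrow> (\<Sum>s\<in>UNIV. c s * n s) = 0"
proof -
  obtain h where h: "bij_betw h {..<CARD('s)} (UNIV :: 's set)"
    using ex_bij_betw_nat_finite[of "UNIV :: 's set"] by (auto simp: atLeast0LessThan)
  define g where "g = inv_into {..<CARD('s)} h"
  have g: "g s < CARD('s)" "h (g s) = s" for s
    using h unfolding g_def bij_betw_def
    by (metis UNIV_I inv_into_into lessThan_iff, metis UNIV_I f_inv_into_f)
  \<comment> \<open>All summands are nonnegative, so \<open>R\<close> dominates 1, the sum of
    absolute coefficients of every relation in \<open>C\<close>, and every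
    \<open>1 / \<bar>u s\<bar>\<close>; the last is 0 by convention when \<open>u s = 0\<close>. The
    approximation quality \<open>1 / N\<close> with \<open>N > R\<close> then meets all three
    demands.\<close>
  define R where "R = 1 + (\<Sum>c\<in>C. \<Sum>s\<in>UNIV. \<bar>real_of_int (c s)\<bar>) + (\<Sum>s\<in>UNIV. 1 / \<bar>u s\<bar>)"
  have R1: "R \<ge> 1"
    unfolding R_def by (simp add: add_nonneg_nonneg sum_nonneg)
  have RC: "(\<Sum>s\<in>UNIV. \<bar>real_of_int (c s)\<bar>) \<le> R" if "c \<in> C" for c
  proof -
    have "(\<Sum>s\<in>UNIV. \<bar>real_of_int (c s)\<bar>) \<le> (\<Sum>c\<in>C. \<Sum>s\<in>UNIV. \<bar>real_of_int (c s)\<bar>)"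
      using that assms(1) by (intro member_le_sum) (auto intro: sum_nonneg)
    moreover have "0 \<le> (\<Sum>s\<in>UNIV. 1 / \<bar>u s\<bar>)" by (simp add: sum_nonneg)
    ultimately show ?thesis by (simp add: R_def)
  qed
  have Ru: "1 / \<bar>u s\<bar> \<le> R" for s
  proof -
    have "1 / \<bar>u s\<bar> \<le> (\<Sum>s\<in>UNIV. 1 / \<bar>u s\<bar>)"
      by (intro member_le_sum) auto
    moreover have "0 \<le> (\<Sum>c\<in>C. \<Sum>s\<in>UNIV. \<bar>real_of_int (c s)\<bar>)" by (simp add: sum_nonneg)
    ultimately show ?thesis by (simp add: R_def)
  qed
  obtain N :: nat where N: "R < N" using reals_Archimedean2 by blast
  then have N0: "N > 0" using R1 by linarith
  obtain q p where q: "0 < q" and p: "\<And>i. i < CARD('s) \<Longrightarrow> \<bar>of_int q * u (h i) - of_int (p i)\<bar> < 1 / N"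
    using Dirichlet_approx_simult[OF N0, of "CARD('s)" "\<lambda>i. u (h i)"] by metis
  define n where "n s = p (g s)" for s
  have n: "\<bar>of_int q * u s - of_int (n s)\<bar> < 1 / N" for s
    using p[OF g(1)[of s]] g(2)[of s] by (simp add: n_def)
  have N1: "1 / N \<le> 1" using N0 by simp
  \<comment> \<open>The rounding error is smaller than the rounded number, so rounding keeps its
    sign.\<close>
  have small: "1 / N < \<bar>of_int q * u s\<bar>" if "u s \<noteq> 0" for s
  proof -
    have "1 / N < \<bar>u s\<bar>"
      using le_less_trans[OF Ru[of s] N] that N0 by (simp add: field_simps)
    also have "\<dots> \<le> of_int q * \<bar>u s\<bar>"
      using q by (simp add: mult_le_cancel_right1)
    finally show ?thesis using q by (simp add: abs_mult)
  qed
  have zero: "n s = 0" if "u s = 0" for s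
    using n[of s] N1 that by simp
  have sgn: "n s > 0" if "u s > 0" for s
  proof -
    have "of_int q * u s > 0" using q that by simp
    with n[of s] small[of s] that have "real_of_int (n s) > 0" by linarith
    then show ?thesis by simp
  qed
  have sgn': "n s < 0" if "u s < 0" for s
  proof -
    have "of_int q * u s < 0" using q that by (simp add: mult_pos_neg)
    with n[of s] small[of s] that have "real_of_int (n s) < 0" by linarith
    then show ?thesis by simp
  qed
  show thesis
  proof (rule that)
    show "n s > 0 \<longleftrightarrow> u s > 0" "n s < 0 \<longleftrightarrow> u s < 0" for s
      using zero[of s] sgn[of s] sgn'[of s] by (cases "u s" "0::real" rule: linorder_cases; force)+
    fix c assume c: "c \<in> C"
    have "real_of_int (\<Sum>s\<in>UNIV. c s * n s) =
        of_int q * (\<Sum>s\<in>UNIV. of_int (c s) * u s)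
        - (\<Sum>s\<in>UNIV. of_int (c s) * (of_int q * u s - of_int (n s)))"
      by (simp add: sum_subtractf sum_distrib_left algebra_simps)
    also have "\<dots> = - (\<Sum>s\<in>UNIV. of_int (c s) * (of_int q * u s - of_int (n s)))"
      using C[OF c] by simp
    finally have "\<bar>real_of_int (\<Sum>s\<in>UNIV. c s * n s)\<bar> \<le>
        (\<Sum>s\<in>UNIV. \<bar>of_int (c s) * (of_int q * u s - of_int (n s))\<bar>)"
      by (simp only: abs_minus_cancel sum_abs)
    also have "\<dots> \<le> (\<Sum>s\<in>UNIV. \<bar>of_int (c s)\<bar> * (1 / N))"
      unfolding abs_mult using n by (intro sum_mono mult_left_mono) (auto intro: less_imp_le)
    also have "\<dots> = (\<Sum>s\<in>UNIV. \<bar>real_of_int (c s)\<bar>) / N"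
      by (simp add: sum_divide_distrib)
    \<comment> \<open>The left-hand side is the absolute value of an integer, so it must be
      0.\<close>
    also have "\<dots> < 1"
      using le_less_trans[OF RC[OF c] N] N0 by simp
    finally show "(\<Sum>s\<in>UNIV. c s * n s) = 0" by linarith
  qed
qed

section \<open>Words with prescribed letter counts\<close>

lemma exists_word_with_counts:
  fixes k :: "'s::finite \<Rightarrow> nat"
  obtains xs where "\<And>s. count_list xs s = k s"
proof -
  obtain xs where xs: "mset xs = (\<Sum>s\<in>UNIV. replicate_mset (k s) s)"
    using ex_mset by blast
  have "count_list xs s = k s" for s
    by (simp add: count_mset[symmetric] xs count_sum)
  then show thesis using that by blast
qed

lemma sum_list_map_eq_sum_count_real:
  "(\<Sum>x\<leftarrow>xs. f x) = (\<Sum>s\<in>UNIV. real (count_list xs s) * f (s::'s::finite))"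
proof (induction xs)
  case (Cons x xs)
  have "(\<Sum>s\<in>UNIV. real (count_list (x # xs) s) * f s) =
      (\<Sum>s\<in>UNIV. real (count_list xs s) * f s + (if s = x then f s else 0))"
    by (intro sum.cong) (auto simp: algebra_simps)
  then show ?case
    using Cons by (simp add: sum.distrib)
qed simp

lemma sum_list_map_additive:
  assumes "Modules.additive f"
  shows "f (sum_list (map S xs)) = (\<Sum>s\<in>UNIV. real (count_list xs s) * f (S (s::'s::finite)))"
proof -
  have "f (sum_list (map S xs)) = (\<Sum>x\<leftarrow>xs. f (S x))"
    by (induction xs) (simp_all add: Modules.additive.zero[OF assms] Modules.additive.add[OF assms])
  then show ?thesis by (simp add: sum_list_map_eq_sum_count_real)
qed

lemma sum_list_concat_replicate:
  "sum_list (map S (concat (replicate N xs))) = nat_mult N (sum_list (map S xs))"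
  by (induction N) simp_all

lemma length_eq_sum_count: "length xs = (\<Sum>s\<in>UNIV. count_list xs (s::'s::finite))"
  by (simp add: sum_count_set)

text \<open>An integer vector with the signs of \<open>u\<close> that satisfies the same integer
  relations supplies the letter counts: its positive part for one word, its negative part for the
  other. The two sums then have equal rational coordinates, hence agree up to torsion.\<close>

lemma words_from_orthogonal_vector:
  fixes S :: "'s::finite \<Rightarrow> 'a::ab_group_add" and u :: "real ^ 's"
  assumes "semigroup_generators S"
    and orth: "\<And>a. a \<in> character_space S \<Longrightarrow> u \<bullet> a = 0" and sum: "(\<Sum>s\<in>UNIV. u $ s) = 0"
  obtains xs ys where "length xs = length ys" "sum_list (map S xs) = sum_list (map S ys)"
    "set xs = {s. u $ s > 0}" "set ys = {s. u $ s < 0}"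
proof -
  obtain I and c :: "'s \<Rightarrow> 'a \<Rightarrow> rat" where card: "card I = group_rank TYPE('a)" and
    add: "\<forall>i. Modules.additive (\<lambda>g. real_of_rat (c i g))" and
    dual: "\<forall>i\<in>I. \<forall>j\<in>I. c i (S j) = of_bool (i = j)" and
    expand: "\<forall>f g. Modules.additive f \<longrightarrow> f g = (\<Sum>i\<in>I. real_of_rat (c i g) * f (S i))" and
    torsion: "\<forall>g. (\<forall>i\<in>I. c i g = 0) \<longrightarrow> (\<exists>N>0. nat_mult N g = 0)"
    using tensor_coordinates[OF assms(1)] .
  note add = add[rule_format] and dual = dual[rule_format] and expand = expand[rule_format]
    and torsion = torsion[rule_format]
  have "\<exists>D>0. \<forall>s. of_nat D * c i (S s) \<in> \<int>" for i
  proof -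
    have "\<forall>s. \<exists>N>0. of_nat N * c i (S s) \<in> \<int>"
      using rat_denominator by blast
    then obtain d where d: "\<And>s. d s > 0 \<and> of_nat (d s) * c i (S s) \<in> \<int>"
      by metis
    have "of_nat (\<Prod>s\<in>UNIV. d s) * c i (S s) \<in> \<int>" for s
    proof (rule Ints_of_nat_dvd_mult)
      show "of_nat (d s) * c i (S s) \<in> \<int>" using d by blast
      show "d s dvd (\<Prod>s\<in>UNIV. d s)" by (rule dvd_prodI) simp_all
    qed
    then show ?thesis
      using d by (intro exI[of _ "\<Prod>s\<in>UNIV. d s"] conjI allI) (simp_all add: prod_pos)
  qed
  then obtain D where D: "\<And>i. D i > 0" "\<And>i s. of_nat (D i) * c i (S s) \<in> \<int>"
    by metis
  define z where "z i s = \<lfloor>of_nat (D i) * c i (S s)\<rfloor>" for i s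
  have "of_int (z i s) = of_nat (D i) * c i (S s)" for i s
    unfolding z_def using D(2)[of i s] by (metis Ints_cases floor_of_int)
  then have "real_of_rat (of_int (z i s)) = real_of_rat (of_nat (D i) * c i (S s))" for i s
    by simp
  then have z: "real_of_int (z i s) = real (D i) * of_rat (c i (S s))" for i s
    by (simp add: of_rat_mult)
  \<comment> \<open>The constant relation makes the two words equally long; the relations
    \<open>z i\<close> are the coordinates with denominators cleared.\<close>
  have rel: "(\<Sum>s\<in>UNIV. real_of_int (w s) * u $ s) = 0" if "w \<in> insert (\<lambda>_. 1) (z ` I)" for w
    using that
  proof
    assume "w \<in> z ` I"
    then obtain i where w: "w = z i" by blast
    have "(\<chi> s. real_of_rat (c i (S s))) \<in> character_space S"
      unfolding character_space_def using add by fastforce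
    then have "0 = real (D i) * (u \<bullet> (\<chi> s. real_of_rat (c i (S s))))"
      using orth by simp
    also have "\<dots> = (\<Sum>s\<in>UNIV. real_of_int (w s) * u $ s)"
      unfolding w z by (simp add: inner_vec_def sum_distrib_left mult_ac)
    finally show ?thesis by simp
  qed (use sum in simp)
  obtain n :: "'s \<Rightarrow> int" where n: "\<And>s. n s > 0 \<longleftrightarrow> u $ s > 0" "\<And>s. n s < 0 \<longleftrightarrow> u $ s < 0"
    "\<And>w. w \<in> insert (\<lambda>_. 1) (z ` I) \<Longrightarrow> (\<Sum>s\<in>UNIV. w s * n s) = 0"
    using integer_vector_same_signs[of "insert (\<lambda>_. 1) (z ` I)", OF _ rel] by auto
  obtain xs ys where xs: "\<And>s. count_list xs s = nat (n s)"
    and ys: "\<And>s. count_list ys s = nat (- n s)"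
    using exists_word_with_counts[of "\<lambda>s. nat (n s)"] exists_word_with_counts[of "\<lambda>s. nat (- n s)"]
    by metis
  have diff: "real (count_list xs s) - real (count_list ys s) = of_int (n s)" for s
    by (simp add: xs ys)
  have "real (length xs) - real (length ys) = of_int (\<Sum>s\<in>UNIV. n s)"
    by (simp add: length_eq_sum_count diff sum_subtractf[symmetric])
  then have len: "length xs = length ys"
    using n(3)[of "\<lambda>_. 1"] by (simp del: of_int_sum)
  have coord: "c i (sum_list (map S xs) - sum_list (map S ys)) = 0" if "i \<in> I" for i
  proof -
    have "real_of_rat (c i (sum_list (map S xs) - sum_list (map S ys))) =
       (\<Sum>s\<in>UNIV. of_int (n s) * of_rat (c i (S s)))"
      by (simp add: Modules.additive.diff[OF add] sum_list_map_additive[OF add]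
        sum_subtractf[symmetric] diff left_diff_distrib[symmetric])
    also have "real (D i) * \<dots> = of_int (\<Sum>s\<in>UNIV. z i s * n s)"
      by (simp add: z sum_distrib_left mult_ac)
    also have "\<dots> = 0" using n(3)[of "z i"] that by simp
    finally show ?thesis using D(1)[of i] by simp
  qed
  obtain N where N: "N > 0" "nat_mult N (sum_list (map S xs) - sum_list (map S ys)) = 0"
    using torsion coord by blast
  have "nat_mult N (sum_list (map S xs)) = nat_mult N (sum_list (map S ys))"
    using nat_mult_add_right[of N "sum_list (map S xs) - sum_list (map S ys)" "sum_list (map S ys)"]
      N(2) by simp
  moreover have "s \<in> set xs \<longleftrightarrow> n s > 0" "s \<in> set ys \<longleftrightarrow> n s < 0" for s
    using count_list_0_iff[of xs s] count_list_0_iff[of ys s] xs[of s] ys[of s] by auto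
  then have "set xs = {s. u $ s > 0}" "set ys = {s. u $ s < 0}"
    using n(1,2) by auto
  \<comment> \<open>Repeating both words \<open>N\<close> times turns the equality of the
    \<open>N\<close>-fold multiples into equality of the sums; \<open>N > 0\<close> keeps the sets
    of letters.\<close>
  ultimately show thesis
    using that[of "concat (replicate N xs)" "concat (replicate N ys)"] len N(1)
    by (simp add: sum_list_concat_replicate length_concat sum_list_replicate)
qed

section \<open>Central weights\<close>

definition prob_simplex :: "(real ^ 's::finite) set" where
  "prob_simplex = {p. (\<forall>s. 0 \<le> p $ s) \<and> (\<Sum>s\<in>UNIV. p $ s) = 1}"

definition word_weight :: "real ^ 's \<Rightarrow> 's::finite list \<Rightarrow> real" where
  "word_weight p xs = prod_list (map (($) p) xs)"

definition central_weights :: "('s::finite \<Rightarrow> 'a::ab_group_add) \<Rightarrow> (real ^ 's) set" where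
  "central_weights S = {p \<in> prob_simplex. \<forall>xs ys. length xs = length ys \<longrightarrow>
     sum_list (map S xs) = sum_list (map S ys) \<longrightarrow> word_weight p xs = word_weight p ys}"

lemma central_weightsD:
  assumes "p \<in> central_weights S"
  shows "p \<in> prob_simplex" "\<And>s. 0 \<le> p $ s" "(\<Sum>s\<in>UNIV. p $ s) = 1"
    "\<And>xs ys. length xs = length ys \<Longrightarrow> sum_list (map S xs) = sum_list (map S ys) \<Longrightarrow>
      word_weight p xs = word_weight p ys"
  using assms unfolding central_weights_def prob_simplex_def by blast+

lemma word_weight_Nil [simp]: "word_weight p [] = 1"
  and word_weight_Cons [simp]: "word_weight p (x # xs) = p $ x * word_weight p xs"
  by (simp_all add: word_weight_def)

lemma word_weight_append: "word_weight p (xs @ ys) = word_weight p xs * word_weight p ys"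
  by (simp add: word_weight_def)

lemma word_weight_nonneg: "(\<And>s. 0 \<le> p $ s) \<Longrightarrow> 0 \<le> word_weight p xs"
  by (induction xs) auto

lemma word_weight_eq_0_iff: "word_weight p xs = 0 \<longleftrightarrow> (\<exists>s\<in>set xs. p $ s = 0)"
  by (induction xs) auto

lemma word_weight_mono:
  assumes "\<And>s. s \<in> set xs \<Longrightarrow> 0 \<le> p $ s \<and> p $ s \<le> q $ s"
  shows "0 \<le> word_weight p xs \<and> word_weight p xs \<le> word_weight q xs"
  using assms
proof (induction xs)
  case (Cons x xs)
  then have "0 \<le> word_weight p xs \<and> word_weight p xs \<le> word_weight q xs" "0 \<le> p $ x" "p $ x \<le> q $ x"
    by auto
  then show ?case
    by (simp add: mult_mono)
qed simp

lemma word_weight_strict_mono: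
  assumes "xs \<noteq> []" "\<And>s. s \<in> set xs \<Longrightarrow> 0 \<le> p $ s \<and> p $ s < q $ s"
  shows "word_weight p xs < word_weight q xs"
  using assms
proof (induction xs rule: list_nonempty_induct)
  case (cons x xs)
  have "0 \<le> word_weight p xs"
    using word_weight_mono[of xs p q] cons.prems less_imp_le by (metis list.set_intros(2))
  moreover have "word_weight p xs < word_weight q xs" "0 \<le> p $ x" "p $ x < q $ x"
    using cons by auto
  ultimately show ?case
    by (simp add: mult_strict_mono')
qed simp

lemma ln_word_weight:
  assumes "\<And>s. s \<in> set xs \<Longrightarrow> 0 < p $ s"
  shows "0 < word_weight p xs \<and> ln (word_weight p xs) = (\<Sum>x\<leftarrow>xs. ln (p $ x))"
  using assms
proof (induction xs)
  case (Cons x xs)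
  then show ?case by (simp add: ln_mult_pos)
qed simp

lemma continuous_on_word_weight: "continuous_on A (\<lambda>p. word_weight p xs)"
  by (induction xs) (auto intro!: continuous_intros)

lemma convex_prob_simplex: "convex prob_simplex"
  unfolding convex_def prob_simplex_def
  by (auto simp: sum.distrib sum_distrib_left[symmetric])

lemma prob_simplex_le_1:
  assumes "p \<in> prob_simplex"
  shows "p $ s \<le> 1"
proof -
  have "p $ s \<le> (\<Sum>s\<in>UNIV. p $ s)"
    using assms by (intro member_le_sum) (auto simp: prob_simplex_def)
  then show ?thesis using assms by (simp add: prob_simplex_def)
qed

lemma compact_prob_simplex: "compact (prob_simplex :: (real ^ 's::finite) set)"
proof -
  have "closed (prob_simplex :: (real ^ 's) set)"
    unfolding prob_simplex_def
    by (intro closed_Collect_conj closed_Collect_all closed_Collect_le closed_Collect_eq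
        continuous_intros)
  moreover have "prob_simplex \<subseteq> cbox (0 :: real ^ 's) (\<chi> i. 1)"
    using prob_simplex_le_1 by (auto simp: mem_box_cart) (simp add: prob_simplex_def)
  ultimately show ?thesis
    by (metis bounded_cbox bounded_subset compact_eq_bounded_closed)
qed

lemma axis_in_prob_simplex: "axis s 1 \<in> prob_simplex"
  by (simp add: prob_simplex_def axis_def)

lemma compact_central_weights: "compact (central_weights S)"
proof -
  have "closed {p. \<forall>xs ys. length xs = length ys \<longrightarrow>
     sum_list (map S xs) = sum_list (map S ys) \<longrightarrow> word_weight p xs = word_weight p ys}"
    by (intro closed_Collect_all closed_Collect_imp closed_Collect_eq continuous_on_word_weight) auto
  then have "compact (prob_simplex \<inter> {p. \<forall>xs ys. length xs = length ys \<longrightarrow>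
     sum_list (map S xs) = sum_list (map S ys) \<longrightarrow> word_weight p xs = word_weight p ys})"
    by (rule compact_Int_closed[OF compact_prob_simplex])
  then show ?thesis
    unfolding central_weights_def Int_def by simp
qed

text \<open>A point is relatively interior iff every segment from a point of the set to it can be
  prolonged. A zero coordinate \<open>s\<close> blocks the segment from the vertex
  \<open>axis s 1\<close>. If all coordinates are at least \<open>m > 0\<close>, the factor
  \<open>1 + m\<close> is safe, since \<open>m * x $ s \<le> m \<le> p $ s\<close>.\<close>

lemma rel_interior_prob_simplex:
  "rel_interior prob_simplex = {p \<in> prob_simplex. \<forall>s::'s::finite. 0 < p $ s}"
proof -
  have ne: "(prob_simplex :: (real ^ 's) set) \<noteq> {}"
    using axis_in_prob_simplex by blast
  have "0 < p $ s" if p: "p \<in> rel_interior prob_simplex" for p :: "real ^ 's" and s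
  proof (rule ccontr)
    have "p \<in> prob_simplex" using p rel_interior_subset by blast
    moreover assume "\<not> 0 < p $ s"
    ultimately have "p $ s = 0" by (simp add: prob_simplex_def order.antisym not_less)
    obtain e where "e > 1" "(1 - e) *\<^sub>R axis s 1 + e *\<^sub>R p \<in> prob_simplex"
      using p axis_in_prob_simplex convex_rel_interior_iff[OF convex_prob_simplex ne] by blast
    then have "0 \<le> ((1 - e) *\<^sub>R axis s 1 + e *\<^sub>R p) $ s"
      unfolding prob_simplex_def by blast
    with \<open>e > 1\<close> \<open>p $ s = 0\<close> show False by (simp add: axis_def)
  qed
  moreover have "p \<in> rel_interior prob_simplex"
    if p: "p \<in> prob_simplex" "\<forall>s. 0 < p $ s" for p :: "real ^ 's"
    unfolding convex_rel_interior_iff[OF convex_prob_simplex ne]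
  proof
    fix x :: "real ^ 's" assume x: "x \<in> prob_simplex"
    define m where "m = Min (range (($) p))"
    have m: "0 < m" "\<And>s. m \<le> p $ s"
      using p(2) by (auto simp: m_def)
    have "0 \<le> (1 - (1 + m)) * x $ s + (1 + m) * p $ s" for s
    proof -
      have "m * x $ s \<le> m" using m prob_simplex_le_1[OF x, of s] by simp
      moreover have "0 \<le> m * p $ s" using m p(2) by (simp add: less_imp_le)
      ultimately show ?thesis using m(2)[of s] by (simp add: algebra_simps)
    qed
    then have "(1 - (1 + m)) *\<^sub>R x + (1 + m) *\<^sub>R p \<in> prob_simplex"
      using x p(1) unfolding prob_simplex_def
      by (simp add: sum.distrib sum_subtractf sum_distrib_left[symmetric] sum_negf)
    then show "\<exists>e>1. (1 - e) *\<^sub>R x + e *\<^sub>R p \<in> prob_simplex"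
      using m(1) by (intro exI[of _ "1 + m"]) auto
  qed
  ultimately show ?thesis
    using rel_interior_subset by blast
qed

text \<open>If the difference of two central weights is orthogonal to all characters, it has the sign
  pattern of an integer relation between words; comparing the weights of the two words forces
  the difference to vanish.\<close>

lemma central_weights_unique:
  assumes S: "semigroup_generators S"
    and p: "p \<in> central_weights S" and q: "q \<in> central_weights S"
    and orth: "\<And>a. a \<in> character_space S \<Longrightarrow> (p - q) \<bullet> a = 0"
  shows "p = q"
proof (rule ccontr)
  assume "p \<noteq> q"
  have sum: "(\<Sum>s\<in>UNIV. (p - q) $ s) = 0"
    using central_weightsD(3)[OF p] central_weightsD(3)[OF q] by (simp add: sum_subtractf)
  obtain xs ys where w: "length xs = length ys" "sum_list (map S xs) = sum_list (map S ys)"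
    "set xs = {s. (p - q) $ s > 0}" "set ys = {s. (p - q) $ s < 0}"
    using words_from_orthogonal_vector[OF S orth sum] by blast
  have "\<exists>s. (p - q) $ s > 0"
  proof (rule ccontr)
    assume "\<not> (\<exists>s. (p - q) $ s > 0)"
    then have "\<forall>s\<in>UNIV. - (p - q) $ s = 0"
      using sum by (subst sum_nonneg_eq_0_iff [symmetric]) (simp_all add: not_less sum_subtractf)
    then show False using \<open>p \<noteq> q\<close> by (simp add: vec_eq_iff)
  qed
  \<comment> \<open>Nonemptiness makes the first inequality below strict; the second one may be an
    equality.\<close>
  then have "xs \<noteq> []" using w(3) by auto
  then have "word_weight q xs < word_weight p xs"
    using w(3) central_weightsD(2)[OF q] by (intro word_weight_strict_mono) auto
  also have "word_weight p xs = word_weight p ys"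
    using central_weightsD(4)[OF p w(1,2)] .
  also have "\<dots> \<le> word_weight q ys"
    using w(4) central_weightsD(2)[OF p] by (intro conjunct2[OF word_weight_mono]) auto
  also have "\<dots> = word_weight q xs"
    using central_weightsD(4)[OF q w(1,2)] ..
  finally show False by simp
qed

text \<open>A letter with \<open>p $ s = 0\<close> has negative difference and so occurs in
  \<open>ys\<close>. Then both words have weight 0, but on the letters of \<open>xs\<close> the
  weight \<open>p\<close> exceeds the positive \<open>q\<close>. This identifies the positive
  central weights as those lying over the relative interior of the polytope.\<close>

lemma central_weights_positive:
  assumes S: "semigroup_generators S"
    and p: "p \<in> central_weights S" and q: "q \<in> prob_simplex" "\<And>s. 0 < q $ s"
    and orth: "\<And>a. a \<in> character_space S \<Longrightarrow> (p - q) \<bullet> a = 0"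
  shows "0 < p $ s"
proof (rule ccontr)
  assume "\<not> 0 < p $ s"
  with central_weightsD(2)[OF p, of s] have s: "p $ s = 0"
    by simp
  have sum: "(\<Sum>s\<in>UNIV. (p - q) $ s) = 0"
    using central_weightsD(3)[OF p] q by (simp add: prob_simplex_def sum_subtractf)
  obtain xs ys where w: "length xs = length ys" "sum_list (map S xs) = sum_list (map S ys)"
    "set xs = {s. (p - q) $ s > 0}" "set ys = {s. (p - q) $ s < 0}"
    using words_from_orthogonal_vector[OF S orth sum] by blast
  have "s \<in> set ys" using w(4) s q(2)[of s] by simp
  with s have "word_weight p ys = 0"
    by (auto simp: word_weight_eq_0_iff)
  moreover have "word_weight p xs = word_weight p ys"
    using central_weightsD(4)[OF p w(1,2)] .
  ultimately have "word_weight p xs = 0" by simp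
  then obtain t where "t \<in> set xs" "p $ t = 0"
    by (auto simp: word_weight_eq_0_iff)
  then show False
    using w(3) q(2)[of t] by simp
qed

section \<open>Existence in each fibre by maximising the entropy\<close>

lemma entropy_continuous: "continuous_on {0..} (\<lambda>x::real. - (x * ln x))"
  unfolding continuous_on_def
proof
  fix x :: real assume "x \<in> {0..}"
  then consider "x = 0" | "x > 0" by force
  then show "((\<lambda>x. - (x * ln x)) \<longlongrightarrow> - (x * ln x)) (at x within {0..})"
  proof cases
    case 1
    have "((\<lambda>x::real. - (x * ln x)) \<longlongrightarrow> 0) (at_right 0)"
      by real_asymp
    then show ?thesis
      using 1 by (simp add: at_within_Ici_at_right)
  next
    case 2
    then show ?thesis
      by (intro tendsto_intros) (auto intro: tendsto_ident_at)
  qed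
qed

text \<open>Concavity: the graph lies below its tangent at \<open>y\<close>, which reduces to
  \<open>ln t \<le> t - 1\<close> at \<open>t = y / x\<close>. The tangent is taken at the positive
  point \<open>y\<close>, so that \<open>x\<close> may be 0.\<close>

lemma entropy_tangent_ineq:
  fixes x y :: real
  assumes "0 \<le> x" "0 < y"
  shows "- (y * ln y) - - (x * ln x) \<ge> - ((ln y + 1) * (y - x))"
proof (cases "x = 0")
  case False
  then have x: "0 < x" using assms by simp
  have "ln (y / x) \<le> y / x - 1"
    using x assms by (intro ln_le_minus_one) simp
  then have "x * (ln y - ln x) \<le> x * (y / x - 1)"
    using x assms by (simp add: ln_div)
  also have "\<dots> = y - x" using x by (simp add: field_simps)
  finally show ?thesis by (simp add: algebra_simps)
qed (use assms in \<open>simp add: algebra_simps\<close>)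

text \<open>The maximiser of the entropy in a fibre is a central weight: moving it in the direction of a
  relation between two words does not increase the entropy.\<close>

lemma central_weights_exists:
  fixes S :: "'s::finite \<Rightarrow> 'a::ab_group_add"
  assumes p0: "p0 \<in> prob_simplex"
  obtains p where "p \<in> central_weights S" "\<And>a. a \<in> character_space S \<Longrightarrow> (p - p0) \<bullet> a = 0"
proof -
  define F where "F = prob_simplex \<inter> {p. \<forall>a\<in>character_space S. (p - p0) \<bullet> a = 0}"
  define H where "H p = (\<Sum>s\<in>UNIV. - (p $ s * ln (p $ s)))" for p :: "real ^ 's"
  have "closed {p. \<forall>a\<in>character_space S. (p - p0) \<bullet> a = 0}"
    unfolding Ball_def
    by (intro closed_Collect_all closed_Collect_imp closed_Collect_eq continuous_intros) simp
  then have "compact F"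
    unfolding F_def by (intro compact_Int_closed compact_prob_simplex)
  moreover have "F \<noteq> {}" using p0 unfolding F_def by auto
  moreover have "continuous_on F H"
    unfolding H_def
    by (intro continuous_on_sum continuous_on_compose2[OF entropy_continuous] continuous_intros)
      (auto simp: F_def prob_simplex_def)
  ultimately obtain p where p: "p \<in> F" and max: "\<And>q. q \<in> F \<Longrightarrow> H q \<le> H p"
    using continuous_attains_sup[of F H] by blast
  have p_nonneg: "0 \<le> p $ s" for s using p by (simp add: F_def prob_simplex_def)
  \<comment> \<open>Exchanging the two words gives the reverse inequality. The asymmetry allows
    \<open>ys\<close> to be assumed of positive weight while \<open>xs\<close> may still contain
    letters of weight 0.\<close>
  have le: "word_weight p ys \<le> word_weight p xs"
    if len: "length xs = length ys" and sums: "sum_list (map S xs) = sum_list (map S ys)" for xs ys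
  proof (cases "\<exists>s\<in>set ys. p $ s = 0")
    case True
    then have "word_weight p ys = 0" by (simp add: word_weight_eq_0_iff)
    then show ?thesis using word_weight_nonneg[of p xs] p_nonneg by simp
  next
    case False
    then have ys: "0 < p $ s" if "s \<in> set ys" for s
      using that p_nonneg[of s] by (metis order_le_less)
    \<comment> \<open>Trading the letters of \<open>ys\<close> for those of \<open>xs\<close>
      preserves the total mass, by equal lengths, and the pairing with every character, by equal
      sums. So \<open>c\<close> is a direction along the fibre.\<close>
    define c where "c = (\<chi> s. real (count_list xs s) - real (count_list ys s))"
    have c_nonneg: "0 \<le> c $ s" if "p $ s = 0" for s
    proof -
      have "count_list ys s = 0" using that ys[of s] by (auto simp: count_list_0_iff)
      then show ?thesis by (simp add: c_def)
    qed
    have c_pos: "0 < c $ s" if "p $ s = 0" "s \<in> set xs" for s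
    proof -
      have "count_list ys s = 0" using that ys[of s] by (auto simp: count_list_0_iff)
      moreover have "count_list xs s \<noteq> 0" using that by (simp add: count_list_0_iff)
      ultimately show ?thesis by (simp add: c_def)
    qed
    have sum_c: "(\<Sum>s\<in>UNIV. c $ s) = 0"
      using len by (simp add: c_def sum_subtractf length_eq_sum_count flip: of_nat_sum)
    have orth_c: "c \<bullet> a = 0" if "a \<in> character_space S" for a
    proof -
      obtain f where f: "Modules.additive f" "\<And>s. a $ s = f (S s)"
        using \<open>a \<in> character_space S\<close> unfolding character_space_def by blast
      have "c \<bullet> a = f (sum_list (map S xs)) - f (sum_list (map S ys))"
        by (simp add: inner_vec_def sum_list_map_additive[OF f(1)] f(2) c_def algebra_simps sum_subtractf)
      then show ?thesis using sums by simp
    qed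
    \<comment> \<open>For small \<open>\<epsilon>\<close> the moved point stays in the simplex:
      positive letters remain positive, and letters of weight 0 do not occur in \<open>ys\<close>,
      so \<open>c\<close> is nonnegative there and positive if they occur in
      \<open>xs\<close>.\<close>
    have "\<forall>\<^sub>F \<epsilon> in at_right 0. 0 < \<epsilon> \<and> (\<forall>s. 0 < p $ s \<longrightarrow> 0 < (p + \<epsilon> *\<^sub>R c) $ s)"
    proof (intro eventually_conj eventually_all_finite)
      show "\<forall>\<^sub>F \<epsilon> in at_right (0::real). 0 < \<epsilon>"
        by (simp add: eventually_at_right_less)
      fix s
      show "\<forall>\<^sub>F \<epsilon> in at_right 0. 0 < p $ s \<longrightarrow> 0 < (p + \<epsilon> *\<^sub>R c) $ s"
      proof (cases "0 < p $ s")
        case True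
        have "((\<lambda>\<epsilon>. (p + \<epsilon> *\<^sub>R c) $ s) \<longlongrightarrow> (p + 0 *\<^sub>R c) $ s) (at_right 0)"
          by (intro tendsto_intros)
        then have "\<forall>\<^sub>F \<epsilon> in at_right 0. 0 < (p + \<epsilon> *\<^sub>R c) $ s"
          using True by (intro order_tendstoD(1)[of _ "(p + 0 *\<^sub>R c) $ s"]) auto
        then show ?thesis by eventually_elim simp
      qed simp
    qed
    \<comment> \<open>The comparison is made at the moved point, where every letter of both words is
      positive and logarithms apply; letting \<open>\<epsilon>\<close> tend to 0 gives it at
      \<open>p\<close>.\<close>
    then have "\<forall>\<^sub>F \<epsilon> in at_right 0. word_weight (p + \<epsilon> *\<^sub>R c) ys \<le> word_weight (p + \<epsilon> *\<^sub>R c) xs"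
    proof eventually_elim
      case (elim \<epsilon>)
      define q where "q = p + \<epsilon> *\<^sub>R c"
      have \<epsilon>: "0 < \<epsilon>" and q_pos: "\<And>s. 0 < p $ s \<Longrightarrow> 0 < q $ s"
        using elim unfolding q_def by auto
      have q_nonneg: "0 \<le> q $ s" for s
        using q_pos[of s] c_nonneg[of s] p_nonneg[of s] \<epsilon> by (cases "p $ s = 0") (auto simp: q_def)
      have q_words: "0 < q $ s" if "s \<in> set xs \<union> set ys" for s
        using that q_pos[of s] c_pos[of s] ys[of s] p_nonneg[of s] \<epsilon>
        by (cases "p $ s = 0") (auto simp: q_def)
      have "q \<in> F"
        using p q_nonneg sum_c orth_c unfolding F_def prob_simplex_def
        by (auto simp: q_def sum.distrib sum_distrib_left[symmetric] inner_diff_left inner_add_left)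
      then have H_le: "H q - H p \<le> 0" using max by simp
      \<comment> \<open>The tangents at \<open>q\<close> bound \<open>H q - H p\<close> from below
        by this expression, in which the sum of \<open>c\<close> is 0. Since
        \<open>H q \<le> H p\<close>, the logarithmic weight of \<open>xs\<close> at
        \<open>q\<close> is at least that of \<open>ys\<close>.\<close>
      have "- \<epsilon> * ((\<Sum>s\<in>UNIV. c $ s * ln (q $ s)) + (\<Sum>s\<in>UNIV. c $ s)) =
          (\<Sum>s\<in>UNIV. - ((ln (q $ s) + 1) * (q $ s - p $ s)))"
        unfolding sum.distrib [symmetric] sum_distrib_left
        by (intro sum.cong) (simp_all add: q_def algebra_simps)
      also have "\<dots> \<le> (\<Sum>s\<in>UNIV. - (q $ s * ln (q $ s)) - - (p $ s * ln (p $ s)))"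
      proof (rule sum_mono)
        fix s
        show "- ((ln (q $ s) + 1) * (q $ s - p $ s)) \<le> - (q $ s * ln (q $ s)) - - (p $ s * ln (p $ s))"
        proof (cases "q $ s = 0")
          case True
          then have "p $ s = 0" using q_pos[of s] p_nonneg[of s] by force
          then show ?thesis using True by simp
        next
          case False
          then show ?thesis
            using q_nonneg[of s] p_nonneg[of s] by (intro entropy_tangent_ineq) auto
        qed
      qed
      also have "\<dots> = H q - H p"
        unfolding H_def by (rule sum_subtractf)
      also note H_le
      finally have "0 \<le> (\<Sum>s\<in>UNIV. c $ s * ln (q $ s))"
        using \<epsilon> sum_c by (simp add: zero_le_mult_iff)
      also have "\<dots> = (\<Sum>x\<leftarrow>xs. ln (q $ x)) - (\<Sum>x\<leftarrow>ys. ln (q $ x))"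
        by (simp add: c_def sum_list_map_eq_sum_count_real left_diff_distrib sum_subtractf)
      finally show "word_weight q ys \<le> word_weight q xs"
        using ln_word_weight[of xs q] ln_word_weight[of ys q] q_words
        by (metis UnI1 UnI2 diff_ge_0_iff_ge ln_le_cancel_iff)
    qed
    moreover have "((\<lambda>\<epsilon>. word_weight (p + \<epsilon> *\<^sub>R c) zs) \<longlongrightarrow> word_weight (p + 0 *\<^sub>R c) zs) (at_right 0)" for zs
    proof (rule isCont_tendsto_compose[where g = "\<lambda>p. word_weight p zs"])
      show "isCont (\<lambda>p. word_weight p zs) (p + 0 *\<^sub>R c)"
        using continuous_on_word_weight[of UNIV zs] by (simp add: continuous_on_eq_continuous_at)
      show "((\<lambda>\<epsilon>. p + \<epsilon> *\<^sub>R c) \<longlongrightarrow> p + 0 *\<^sub>R c) (at_right 0)"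
        by (intro tendsto_intros)
    qed
    ultimately have "word_weight (p + 0 *\<^sub>R c) ys \<le> word_weight (p + 0 *\<^sub>R c) xs"
      by (intro tendsto_le[of "at_right 0"]) auto
    then show ?thesis by simp
  qed
  have eq: "word_weight p xs = word_weight p ys"
    if "length xs = length ys" "sum_list (map S xs) = sum_list (map S ys)" for xs ys
    using le[OF that] le[OF that[symmetric]] by simp
  show thesis
  proof
    show "p \<in> central_weights S"
      using p eq unfolding central_weights_def F_def by blast
    show "(p - p0) \<bullet> a = 0" if "a \<in> character_space S" for a
      using p that by (simp add: F_def)
  qed
qed

section \<open>The moment map\<close>

lemma orthogonal_projection_exists:
  fixes L :: "'v::euclidean_space set"
  assumes "subspace L"
  obtains \<pi> where "linear \<pi>" "\<forall>x. \<pi> x \<in> L" "\<forall>a\<in>L. \<forall>x. (x - \<pi> x) \<bullet> a = 0"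
proof -
  obtain B where B: "B \<subseteq> L" "pairwise orthogonal B" "\<And>x. x \<in> B \<Longrightarrow> norm x = 1"
    "independent B" "card B = dim L" "span B = L"
    using orthonormal_basis_subspace[OF assms] by metis
  have fin: "finite B" using B(4) independent_imp_finite by blast
  define \<pi> where "\<pi> x = (\<Sum>b\<in>B. (x \<bullet> b) *\<^sub>R b)" for x
  show thesis
  proof (rule that; (intro allI ballI)?)
    show "linear \<pi>"
      by (rule linearI)
        (simp_all add: \<pi>_def inner_add_left scaleR_add_left sum.distrib scaleR_sum_right)
    show "\<pi> x \<in> L" for x
      unfolding \<pi>_def using B(1) assms by (intro subspace_sum subspace_scale) auto
    show "(x - \<pi> x) \<bullet> a = 0" if "a \<in> L" for x a
    proof -
      have proj: "\<pi> x \<bullet> c = x \<bullet> c" if c: "c \<in> B" for c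
      proof -
        have "\<pi> x \<bullet> c = (\<Sum>b\<in>B. if b = c then x \<bullet> c else 0)"
          unfolding \<pi>_def inner_sum_left
        proof (rule sum.cong)
          fix b assume "b \<in> B"
          then show "(x \<bullet> b) *\<^sub>R b \<bullet> c = (if b = c then x \<bullet> c else 0)"
            using B(2) B(3)[OF c] c by (auto simp: pairwise_def orthogonal_def dot_square_norm)
        qed simp
        then show ?thesis using fin c by simp
      qed
      have "a \<in> span B" using that B(6) by simp
      then have "orthogonal (x - \<pi> x) a"
        by (rule orthogonal_to_span) (simp add: orthogonal_def inner_diff_left proj)
      then show ?thesis by (simp add: orthogonal_def)
    qed
  qed
qed

section \<open>Relative interiors and disks under homeomorphisms\<close>

lemma rel_interior_eq_interior_of:
  "rel_interior A = top_of_set (affine hull A) interior_of A"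
  by (simp add: rel_interior_def interior_of_def)

text \<open>Invariance of domain, applied to the map and to its inverse; this is why the affine
  dimensions have to agree.\<close>

lemma homeomorphism_rel_interior:
  fixes A :: "'v::euclidean_space set" and B :: "'w::euclidean_space set"
  assumes h: "homeomorphism A B h k" and aff: "aff_dim A = aff_dim B"
  shows "h ` rel_interior A = rel_interior B"
proof
  have inj: "inj_on h A" "inj_on k B"
    using h by (auto simp: homeomorphism_def inj_on_def) metis+
  have hk: "h ` A = B" "k ` B = A" "continuous_on A h" "continuous_on B k"
    using h by (auto simp: homeomorphism_def)
  have hk': "h \<in> A \<rightarrow> B" "k \<in> B \<rightarrow> A" using hk(1,2) by blast+
  show "h ` rel_interior A \<subseteq> rel_interior B"
    using continuous_image_subset_rel_interior[of A h B, OF hk(3) inj(1) hk'(1)] hk(1) aff by auto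
  have "k ` rel_interior B \<subseteq> rel_interior A"
    using continuous_image_subset_rel_interior[of B k A, OF hk(4) inj(2) hk'(2)] hk(2) aff by auto
  moreover have "h (k y) = y" if "y \<in> rel_interior B" for y
    using that h rel_interior_subset by (metis homeomorphism_def subsetD)
  ultimately show "rel_interior B \<subseteq> h ` rel_interior A"
    by (metis image_subset_iff subsetI image_eqI)
qed

lemma homeomorphism_imp_homeomorphic_map:
  "homeomorphism A B h k \<Longrightarrow> homeomorphic_map (top_of_set A) (top_of_set B) h"
  unfolding homeomorphic_map_maps homeomorphic_maps_def homeomorphism_def
  by (intro exI[of _ k]) (auto simp: continuous_map_in_subtopology)

text \<open>Coordinates in an orthonormal basis preserve the norm, so the unit ball goes to the
  disk. The basis is numbered because the target consists of sequences padded with 0.\<close>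

lemma subspace_homeomorphic_Euclidean_space:
  fixes L :: "'v::euclidean_space set"
  assumes "subspace L"
  obtains \<kappa> where "homeomorphic_map (top_of_set L) (Euclidean_space (dim L)) \<kappa>"
    "\<kappa> ` (L \<inter> cball 0 1) = closed_disk (dim L)"
proof -
  obtain B where B: "B \<subseteq> L" "pairwise orthogonal B" "\<And>x. x \<in> B \<Longrightarrow> norm x = 1"
    "independent B" "card B = dim L" "span B = L"
    using orthonormal_basis_subspace[OF assms] by metis
  define d where "d = dim L"
  have fin: "finite B" using B(4) independent_imp_finite by blast
  then obtain b where b: "bij_betw b {..<d} B"
    using ex_bij_betw_nat_finite[OF fin] B(5) by (auto simp: atLeast0LessThan d_def)
  have bL: "b i \<in> L" if "i < d" for i
    using b B(1) that by (auto simp: bij_betw_def)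
  have orth: "b i \<bullet> b j = of_bool (i = j)" if "i < d" "j < d" for i j
  proof (cases "i = j")
    case True
    have "norm (b i) = 1" using B(3) b that by (auto simp: bij_betw_def)
    then show ?thesis using True by (simp add: dot_square_norm)
  next
    case False
    then have "b i \<noteq> b j" using b that by (auto simp: bij_betw_def inj_on_def)
    moreover have "b i \<in> B" "b j \<in> B" using b that by (auto simp: bij_betw_def)
    ultimately show ?thesis using B(2) False by (auto simp: pairwise_def orthogonal_def)
  qed
  define \<kappa> where "\<kappa> x i = (if i < d then x \<bullet> b i else 0)" for x i
  define \<mu> where "\<mu> y = (\<Sum>i<d. y i *\<^sub>R b i)" for y :: "nat \<Rightarrow> real"
  have \<mu>b: "\<mu> y \<bullet> b j = y j" if "j < d" for y j
    using that by (simp add: \<mu>_def inner_sum_left orth if_distrib cong: if_cong)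
  have \<mu>L: "\<mu> y \<in> L" for y
    unfolding \<mu>_def using bL assms by (intro subspace_sum subspace_scale) auto
  have \<mu>\<kappa>: "\<mu> (\<kappa> x) = x" if "x \<in> L" for x
  proof -
    define z where "z = x - \<mu> (\<kappa> x)"
    have "orthogonal z c" if c: "c \<in> B" for c
    proof -
      obtain j where "j < d" "c = b j"
        using c b by (auto simp: bij_betw_def)
      then show ?thesis
        by (simp add: orthogonal_def z_def inner_diff_left \<mu>b \<kappa>_def)
    qed
    moreover have "z \<in> span B"
      using that \<mu>L assms B(6) by (simp add: z_def subspace_diff)
    ultimately have "orthogonal z z" by (rule orthogonal_to_span[rotated])
    then show ?thesis by (simp add: z_def orthogonal_def)
  qed
  have \<kappa>\<mu>: "\<kappa> (\<mu> y) = y" if "\<forall>i\<ge>d. y i = 0" for y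
    using that by (auto simp: \<kappa>_def \<mu>b)
  have "homeomorphic_maps (top_of_set L) (Euclidean_space d) \<kappa> \<mu>"
    unfolding homeomorphic_maps_def
  proof (intro conjI ballI)
    show "continuous_map (top_of_set L) (Euclidean_space d) \<kappa>"
      unfolding Euclidean_space_def continuous_map_in_subtopology
    proof
      show "continuous_map (top_of_set L) (powertop_real UNIV) \<kappa>"
        unfolding continuous_map_componentwise_UNIV
        by (auto simp: \<kappa>_def intro!: continuous_intros)
    qed (auto simp: \<kappa>_def)
    show "continuous_map (Euclidean_space d) (top_of_set L) \<mu>"
      unfolding continuous_map_in_subtopology
    proof
      have "continuous_map (Euclidean_space d) euclidean (\<lambda>y. y i *\<^sub>R b i)" for i
      proof -
        have "continuous_map (Euclidean_space d) euclideanreal (\<lambda>y. y i)"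
          unfolding Euclidean_space_def
          by (intro continuous_map_from_subtopology continuous_map_product_projection) simp
        moreover have "continuous_map euclideanreal euclidean (\<lambda>r. r *\<^sub>R b i)"
          by (auto intro!: continuous_intros)
        ultimately show ?thesis
          using continuous_map_compose[of "Euclidean_space d" euclideanreal "\<lambda>y. y i" euclidean
              "\<lambda>r. r *\<^sub>R b i"] by (simp add: o_def)
      qed
      then show "continuous_map (Euclidean_space d) euclidean \<mu>"
        unfolding \<mu>_def by (intro continuous_map_sum) auto
    qed (use \<mu>L in auto)
  qed (use \<mu>\<kappa> \<kappa>\<mu> in \<open>auto simp: topspace_Euclidean_space\<close>)
  then have hom: "homeomorphic_map (top_of_set L) (Euclidean_space d) \<kappa>"
    using homeomorphic_map_maps by blast
  have norm: "sqrt (\<Sum>i<d. (\<kappa> x i)\<^sup>2) = norm x" if "x \<in> L" for x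
  proof -
    have "x \<bullet> x = \<mu> (\<kappa> x) \<bullet> x" using \<mu>\<kappa>[OF that] by simp
    also have "\<dots> = (\<Sum>i<d. (\<kappa> x i)\<^sup>2)"
      unfolding \<mu>_def inner_sum_left
      by (intro sum.cong) (simp_all add: \<kappa>_def power2_eq_square inner_commute)
    finally show ?thesis by (simp add: norm_eq_sqrt_inner)
  qed
  have "\<kappa> ` (L \<inter> cball 0 1) = closed_disk d"
  proof
    show "\<kappa> ` (L \<inter> cball 0 1) \<subseteq> closed_disk d"
    proof
      fix y assume "y \<in> \<kappa> ` (L \<inter> cball 0 1)"
      then obtain x where x: "y = \<kappa> x" "x \<in> L" "norm x \<le> 1" by auto
      have "sqrt (\<Sum>i<d. (y i)\<^sup>2) \<le> 1" using norm[OF x(2)] x by simp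
      then show "y \<in> closed_disk d"
        unfolding closed_disk_def topspace_Euclidean_space x(1) by (simp add: \<kappa>_def)
    qed
    show "closed_disk d \<subseteq> \<kappa> ` (L \<inter> cball 0 1)"
    proof
      fix y assume y: "y \<in> closed_disk d"
      then have eq: "\<kappa> (\<mu> y) = y"
        by (intro \<kappa>\<mu>) (simp add: closed_disk_def topspace_Euclidean_space)
      have "norm (\<mu> y) = sqrt (\<Sum>i<d. (y i)\<^sup>2)"
        using norm[OF \<mu>L[of y]] unfolding eq ..
      also have "\<dots> \<le> 1" using y unfolding closed_disk_def by blast
      finally show "y \<in> \<kappa> ` (L \<inter> cball 0 1)"
        using \<mu>L[of y] eq by (intro image_eqI[of _ _ "\<mu> y"]) auto
    qed
  qed
  then show thesis using that hom unfolding d_def by blast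
qed

text \<open>The unit ball of \<open>L\<close> is the intermediate set: it is homeomorphic to
  \<open>Q\<close>, as both are compact, convex and of equal affine dimension. Its affine hull is
  \<open>L\<close>, so its relative interior is its interior in \<open>L\<close>, which coordinates
  on all of \<open>L\<close> carry to the interior of the disk.\<close>

lemma convex_compact_homeomorphic_closed_disk:
  fixes Q :: "'v::euclidean_space set"
  assumes L: "subspace L" and Q: "convex Q" "compact Q" "affine hull Q = L"
  obtains k where
    "homeomorphic_map (top_of_set Q) (subtopology (Euclidean_space (dim L)) (closed_disk (dim L))) k"
    "k ` rel_interior Q = Euclidean_space (dim L) interior_of closed_disk (dim L)"
proof -
  define D where "D = L \<inter> cball (0::'v) 1"
  have "L \<inter> interior (cball 0 1) \<noteq> {}"
    using subspace_0[OF L] by auto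
  then have D: "affine hull D = L" "convex D" "compact D"
    using affine_hull_affine_Int_nonempty_interior[of L "cball 0 1"] L closed_subspace[OF L]
    by (auto simp: D_def subspace_imp_affine subspace_imp_convex convex_Int
        compact_Int_closed Int_commute)
  have aff: "aff_dim Q = aff_dim D"
    by (metis D(1) Q(3) aff_dim_affine_hull)
  obtain h g where h: "homeomorphism Q D h g"
    using homeomorphic_convex_compact_sets[OF Q(1,2) D(2,3) aff] by (auto simp: homeomorphic_def)
  have hom_h: "homeomorphic_map (top_of_set Q) (top_of_set D) h"
    using h by (rule homeomorphism_imp_homeomorphic_map)
  obtain \<kappa> where \<kappa>: "homeomorphic_map (top_of_set L) (Euclidean_space (dim L)) \<kappa>"
    "\<kappa> ` D = closed_disk (dim L)"
    using subspace_homeomorphic_Euclidean_space[OF L] unfolding D_def by blast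
  have "D \<subseteq> L" by (auto simp: D_def)
  have hom_\<kappa>: "homeomorphic_map (top_of_set D)
      (subtopology (Euclidean_space (dim L)) (closed_disk (dim L))) \<kappa>"
    using homeomorphic_map_subtopologies[OF \<kappa>(1), of D "closed_disk (dim L)"] \<kappa>(2) \<open>D \<subseteq> L\<close>
    by (simp add: subtopology_subtopology Int_absorb1 closed_disk_def Int_absorb2)
  show thesis
  proof
    show "homeomorphic_map (top_of_set Q)
        (subtopology (Euclidean_space (dim L)) (closed_disk (dim L))) (\<kappa> \<circ> h)"
      using hom_h hom_\<kappa> by (rule homeomorphic_map_compose)
    have "(\<kappa> \<circ> h) ` rel_interior Q = \<kappa> ` rel_interior D"
      by (simp only: image_comp[symmetric] homeomorphism_rel_interior[OF h aff])
    also have "\<dots> = \<kappa> ` (top_of_set L interior_of D)"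
      by (simp add: rel_interior_eq_interior_of D)
    also have "\<dots> = Euclidean_space (dim L) interior_of closed_disk (dim L)"
      using homeomorphic_map_interior_of[OF \<kappa>(1), of D] \<kappa>(2) \<open>D \<subseteq> L\<close> by simp
    finally show "(\<kappa> \<circ> h) ` rel_interior Q =
        Euclidean_space (dim L) interior_of closed_disk (dim L)" .
  qed
qed

text \<open>The moment map of the family of central weights, written as the orthogonal projection to the
  space of characters, identifies the central weights with a polytope.\<close>

lemma central_weights_homeomorphic_closed_disk:
  fixes S :: "'s::finite \<Rightarrow> 'a::ab_group_add"
  defines "d \<equiv> group_rank TYPE('a)"
  assumes S: "semigroup_generators S"
  obtains m where
    "homeomorphic_map (top_of_set (central_weights S)) (subtopology (Euclidean_space d) (closed_disk d)) m"
    "m ` {p \<in> central_weights S. \<forall>s. 0 < p $ s} = Euclidean_space d interior_of closed_disk d"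
proof -
  define L where "L = character_space S"
  have L: "subspace L" "dim L = d"
    by (simp_all add: L_def d_def subspace_character_space dim_character_space[OF S])
  obtain \<pi> where \<pi>: "linear \<pi>" "\<forall>x. \<pi> x \<in> L" "\<forall>a\<in>L. \<forall>x. (x - \<pi> x) \<bullet> a = 0"
    using orthogonal_projection_exists[OF L(1)] .
  note \<pi> = \<pi>(1) \<pi>(2,3)[rule_format]
  have \<pi>_eq: "\<pi> x = \<pi> y \<longleftrightarrow> (\<forall>a\<in>L. (x - y) \<bullet> a = 0)" for x y
  proof
    assume "\<pi> x = \<pi> y"
    then show "\<forall>a\<in>L. (x - y) \<bullet> a = 0"
      using \<pi>(3)[of _ x] \<pi>(3)[of _ y] by (simp add: inner_diff_left)
  next
    assume *: "\<forall>a\<in>L. (x - y) \<bullet> a = 0"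
    have "\<pi> x - \<pi> y \<in> L" using \<pi>(2) L(1) by (simp add: subspace_diff)
    with * \<pi>(3)[OF this, of x] \<pi>(3)[OF this, of y] have "(\<pi> x - \<pi> y) \<bullet> (\<pi> x - \<pi> y) = 0"
      by (auto simp: inner_diff_left)
    then show "\<pi> x = \<pi> y" by simp
  qed
  define Q where "Q = \<pi> ` prob_simplex"
  have Q: "convex Q" "compact Q"
    using convex_linear_image[OF \<pi>(1) convex_prob_simplex]
      compact_continuous_image[OF _ compact_prob_simplex, of \<pi>] \<pi>(1)
    by (auto simp: Q_def linear_continuous_on linear_conv_bounded_linear)
  have QL: "Q \<subseteq> L" using \<pi>(2) by (auto simp: Q_def)
  have "0 \<in> Q"
  proof -
    \<comment> \<open>Prefixing an arbitrary letter to a word for the inverse of its generator gives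
      a nonempty word with sum 0. Its letter frequencies are orthogonal to every character.\<close>
    obtain ys where ys: "- S undefined = sum_list (map S ys)"
      using S unfolding semigroup_generators_def by blast
    define xs where "xs = undefined # ys"
    have xs: "xs \<noteq> []" "sum_list (map S xs) = 0"
      using ys[symmetric] by (simp_all add: xs_def)
    define p :: "real ^ 's" where "p = (\<chi> s. real (count_list xs s) / real (length xs))"
    have "(\<Sum>s\<in>UNIV. p $ s) = real (length xs) / real (length xs)"
      by (simp add: p_def sum_divide_distrib [symmetric] length_eq_sum_count[of xs])
    then have "p \<in> prob_simplex"
      using xs(1) by (simp add: p_def prob_simplex_def)
    moreover have "p \<bullet> a = 0" if a: "a \<in> L" for a
    proof -
      obtain f where f: "Modules.additive f" "\<And>s. a $ s = f (S s)"
        using a unfolding L_def character_space_def by blast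
      have "p \<bullet> a = f (sum_list (map S xs)) / real (length xs)"
        by (simp add: p_def inner_vec_def sum_list_map_additive[OF f(1)] f(2) sum_divide_distrib)
      then show ?thesis using xs(2) Modules.additive.zero[OF f(1)] by simp
    qed
    then have "\<pi> p = \<pi> 0" by (simp add: \<pi>_eq)
    ultimately show ?thesis
      using linear_0[OF \<pi>(1)] by (metis Q_def image_eqI)
  qed
  \<comment> \<open>A vector of \<open>L\<close> orthogonal to the projected vertices of the simplex
    is orthogonal to the vertices themselves, which form the standard basis, and so is 0.\<close>
  have "span Q = L"
  proof (rule ccontr)
    assume "span Q \<noteq> L"
    then have "span Q \<subset> span L"
      using QL L(1) by (metis psubsetI span_eq_iff span_minimal)
    then obtain a where a: "a \<noteq> 0" "a \<in> span L" "\<And>y. y \<in> span Q \<Longrightarrow> orthogonal a y"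
      using orthogonal_to_subspace_exists_gen by blast
    have "a $ s = 0" for s
    proof -
      have "\<pi> (axis s 1) \<in> Q" by (simp add: Q_def axis_in_prob_simplex)
      then have "\<pi> (axis s 1) \<bullet> a = 0"
        using a(3) by (metis orthogonal_def inner_commute span_base)
      moreover have "a \<in> L" using a(2) L(1) by (metis span_eq_iff)
      ultimately have "axis s 1 \<bullet> a = 0"
        using \<pi>(3)[of a "axis s 1"] by (simp add: inner_diff_left)
      then show ?thesis by (simp add: inner_axis')
    qed
    then show False using a(1) by (simp add: vec_eq_iff)
  qed
  then have aff: "affine hull Q = L"
    using \<open>0 \<in> Q\<close> by (simp add: affine_hull_span_0 hull_inc)
  obtain k where k:
    "homeomorphic_map (top_of_set Q) (subtopology (Euclidean_space d) (closed_disk d)) k"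
    "k ` rel_interior Q = Euclidean_space d interior_of closed_disk d"
    using convex_compact_homeomorphic_closed_disk[OF L(1) Q aff] unfolding L(2) .
  have img: "\<pi> ` central_weights S = Q"
  proof
    show "\<pi> ` central_weights S \<subseteq> Q"
      using central_weightsD(1) by (force simp: Q_def)
    show "Q \<subseteq> \<pi> ` central_weights S"
    proof
      fix x assume "x \<in> Q"
      then obtain p0 where p0: "p0 \<in> prob_simplex" "x = \<pi> p0" by (auto simp: Q_def)
      obtain p where p: "p \<in> central_weights S" "\<And>a. a \<in> L \<Longrightarrow> (p - p0) \<bullet> a = 0"
        using central_weights_exists[OF p0(1)] unfolding L_def by blast
      have "\<pi> p = \<pi> p0" unfolding \<pi>_eq using p(2) by blast
      then show "x \<in> \<pi> ` central_weights S"
        using p0(2) p(1) by (metis image_eqI)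
    qed
  qed
  have inj: "inj_on \<pi> (central_weights S)"
  proof (rule inj_onI)
    fix p q assume pq: "p \<in> central_weights S" "q \<in> central_weights S" "\<pi> p = \<pi> q"
    have "\<forall>a\<in>L. (p - q) \<bullet> a = 0" using pq(3) unfolding \<pi>_eq .
    then show "p = q"
      using central_weights_unique[OF S pq(1,2)] unfolding L_def by blast
  qed
  have cont: "continuous_on A \<pi>" for A
    using \<pi>(1) by (simp add: linear_continuous_on linear_conv_bounded_linear)
  obtain \<rho> where "homeomorphism (central_weights S) Q \<pi> \<rho>"
    using homeomorphism_compact[OF compact_central_weights cont img inj] by blast
  then have hom: "homeomorphic_map (top_of_set (central_weights S)) (top_of_set Q) \<pi>"
    by (rule homeomorphism_imp_homeomorphic_map)
  \<comment> \<open>Linear images commute with relative interiors of convex sets, so the relative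
    interior is the image of all positive probability vectors. The central weight in the fibre of
    such a vector is positive too.\<close>
  have int: "\<pi> ` {p \<in> central_weights S. \<forall>s. 0 < p $ s} = rel_interior Q"
  proof -
    have "rel_interior Q = \<pi> ` {p \<in> prob_simplex. \<forall>s. 0 < p $ s}"
      unfolding Q_def rel_interior_prob_simplex[symmetric]
      using rel_interior_convex_linear_image[OF \<pi>(1) convex_prob_simplex] by simp
    also have "\<dots> = \<pi> ` {p \<in> central_weights S. \<forall>s. 0 < p $ s}"
    proof (intro equalityI subsetI)
      fix x assume "x \<in> \<pi> ` {p \<in> prob_simplex. \<forall>s. 0 < p $ s}"
      then obtain q where q: "q \<in> prob_simplex" "\<And>s. 0 < q $ s" "x = \<pi> q" by blast
      then have "x \<in> \<pi> ` central_weights S" using img by (auto simp: Q_def)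
      then obtain p where p: "p \<in> central_weights S" "x = \<pi> p" by blast
      have "(p - q) \<bullet> a = 0" if "a \<in> character_space S" for a
        using p q that \<pi>_eq[of p q] by (simp add: L_def)
      then have "0 < p $ s" for s
        using central_weights_positive[OF S p(1) q(1,2)] by blast
      then show "x \<in> \<pi> ` {p \<in> central_weights S. \<forall>s. 0 < p $ s}" using p by blast
    next
      fix x assume "x \<in> \<pi> ` {p \<in> central_weights S. \<forall>s. 0 < p $ s}"
      then show "x \<in> \<pi> ` {p \<in> prob_simplex. \<forall>s. 0 < p $ s}"
        using central_weightsD(1) by blast
    qed
    finally show ?thesis ..
  qed
  show thesis
  proof
    show "homeomorphic_map (top_of_set (central_weights S))
        (subtopology (Euclidean_space d) (closed_disk d)) (k \<circ> \<pi>)"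
      using hom k(1) by (rule homeomorphic_map_compose)
    show "(k \<circ> \<pi>) ` {p \<in> central_weights S. \<forall>s. 0 < p $ s} =
        Euclidean_space d interior_of closed_disk d"
      by (simp only: image_comp[symmetric] int k(2))
  qed
qed

section \<open>Central measures on the path space\<close>

lemma mem_cylinder_prefix: "\<omega> \<in> cylinder (map \<omega>' [0..<n]) \<longleftrightarrow> (\<forall>k<n. \<omega> k = \<omega>' k)"
  by (auto simp: cylinder_def)

lemma cylinder_Nil [simp]: "cylinder [] = UNIV"
  by (simp add: cylinder_def)

lemma mem_cylinder_Cons: "\<omega> \<in> cylinder (x # xs) \<longleftrightarrow> \<omega> 0 = x \<and> (\<lambda>k. \<omega> (Suc k)) \<in> cylinder xs"
  by (auto simp: cylinder_def nth_Cons split: nat.splits)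

lemma mem_cylinder_append:
  "\<omega> \<in> cylinder (xs @ ys) \<longleftrightarrow> \<omega> \<in> cylinder xs \<and> (\<lambda>k. \<omega> (length xs + k)) \<in> cylinder ys"
  by (induction xs arbitrary: \<omega>) (simp_all add: mem_cylinder_Cons)

lemma topspace_path_topology [simp]: "topspace path_topology = UNIV"
  by (simp add: path_topology_def)

text \<open>A basic open set of the product restricts finitely many coordinates, hence only
  coordinates below some \<open>n\<close>.\<close>

lemma openin_path_topology_iff:
  fixes U :: "(nat \<Rightarrow> 's) set"
  shows "openin path_topology U \<longleftrightarrow> (\<forall>\<omega>\<in>U. \<exists>n. cylinder (map \<omega> [0..<n]) \<subseteq> U)"
  unfolding path_topology_def openin_product_topology_alt
proof (intro ball_cong refl iffI)
  fix \<omega> :: "nat \<Rightarrow> 's"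
  assume "\<exists>V. finite {i \<in> UNIV. V i \<noteq> topspace (discrete_topology UNIV)} \<and>
    (\<forall>i\<in>UNIV. openin (discrete_topology UNIV) (V i)) \<and> \<omega> \<in> Pi\<^sub>E UNIV V \<and> Pi\<^sub>E UNIV V \<subseteq> U"
  then obtain V where V: "finite {i. V i \<noteq> UNIV}" "\<And>i. \<omega> i \<in> V i" "Pi\<^sub>E UNIV V \<subseteq> U"
    by (auto simp: PiE_iff)
  obtain n where n: "\<And>i. V i \<noteq> UNIV \<Longrightarrow> i < n"
    using V(1) by (auto simp: finite_nat_set_iff_bounded)
  have "cylinder (map \<omega> [0..<n]) \<subseteq> Pi\<^sub>E UNIV V"
    using n V(2) by (auto simp: mem_cylinder_prefix PiE_iff) (metis UNIV_I)
  then show "\<exists>n. cylinder (map \<omega> [0..<n]) \<subseteq> U"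
    using V(3) by blast
next
  fix \<omega> :: "nat \<Rightarrow> 's"
  assume "\<exists>n. cylinder (map \<omega> [0..<n]) \<subseteq> U"
  then obtain n where n: "cylinder (map \<omega> [0..<n]) \<subseteq> U" by blast
  define V where "V i = (if i < n then {\<omega> i} else UNIV)" for i
  have "{i. V i \<noteq> UNIV} \<subseteq> {..<n}" by (auto simp: V_def)
  then have "finite {i. V i \<noteq> UNIV}" using finite_subset by blast
  moreover have "Pi\<^sub>E UNIV V \<subseteq> cylinder (map \<omega> [0..<n])"
  proof
    fix x assume "x \<in> Pi\<^sub>E UNIV V"
    then have "x k \<in> V k" for k by (simp add: PiE_iff)
    then show "x \<in> cylinder (map \<omega> [0..<n])"
      unfolding mem_cylinder_prefix V_def by (metis singletonD)
  qed
  ultimately show "\<exists>V. finite {i \<in> UNIV. V i \<noteq> topspace (discrete_topology UNIV)} \<and>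
    (\<forall>i\<in>UNIV. openin (discrete_topology UNIV) (V i)) \<and> \<omega> \<in> Pi\<^sub>E UNIV V \<and> Pi\<^sub>E UNIV V \<subseteq> U"
    using n by (intro exI[of _ V]) (auto simp: V_def PiE_iff)
qed

lemma openin_path_topology_finitely_many_coordinates:
  assumes "\<And>\<omega> \<omega>'. (\<forall>k<n. \<omega> k = \<omega>' k) \<Longrightarrow> \<omega> \<in> U \<Longrightarrow> \<omega>' \<in> U"
  shows "openin path_topology U"
  unfolding openin_path_topology_iff
proof
  fix \<omega> assume "\<omega> \<in> U"
  have "cylinder (map \<omega> [0..<n]) \<subseteq> U"
  proof
    fix \<omega>' assume "\<omega>' \<in> cylinder (map \<omega> [0..<n])"
    then have "\<forall>k<n. \<omega> k = \<omega>' k" by (simp add: mem_cylinder_prefix)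
    from this \<open>\<omega> \<in> U\<close> show "\<omega>' \<in> U" by (rule assms)
  qed
  then show "\<exists>n. cylinder (map \<omega> [0..<n]) \<subseteq> U" by blast
qed

lemma openin_cylinder: "openin path_topology (cylinder xs)"
  by (rule openin_path_topology_finitely_many_coordinates[of "length xs"]) (auto simp: cylinder_def)

lemma space_path_borel [simp]: "space path_borel = UNIV"
  by (simp add: path_borel_def space_measure_of_conv)

lemma sets_path_borel: "sets path_borel = sigma_sets UNIV {U. openin path_topology U}"
  by (simp add: path_borel_def)

lemma cylinder_in_sets [measurable]: "cylinder xs \<in> sets path_borel"
  unfolding sets_path_borel by (rule sigma_sets.Basic) (simp add: openin_cylinder)

text \<open>There are only countably many words over a finite alphabet, so an open set is a
  countable union of cylinders.\<close>

lemma open_in_sigma_cylinders: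
  fixes U :: "(nat \<Rightarrow> 's::finite) set"
  assumes "openin path_topology U" "sigma_algebra UNIV M" "range cylinder \<subseteq> M"
  shows "U \<in> M"
proof -
  interpret sigma_algebra UNIV M by fact
  have "U = \<Union>(cylinder ` {xs. cylinder xs \<subseteq> U})"
  proof
    show "U \<subseteq> \<Union>(cylinder ` {xs. cylinder xs \<subseteq> U})"
    proof
      fix \<omega> assume "\<omega> \<in> U"
      then obtain n where "cylinder (map \<omega> [0..<n]) \<subseteq> U"
        using assms(1) openin_path_topology_iff by blast
      moreover have "\<omega> \<in> cylinder (map \<omega> [0..<n])" by (simp add: mem_cylinder_prefix)
      ultimately show "\<omega> \<in> \<Union>(cylinder ` {xs. cylinder xs \<subseteq> U})" by blast
    qed
  qed blast
  also have "\<dots> \<in> M"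
    using assms(3) by (intro countable_UN') auto
  finally show ?thesis .
qed

lemma sets_path_borel_cylinders:
  "sets (path_borel :: (nat \<Rightarrow> 's::finite) measure) = sigma_sets UNIV (insert {} (range cylinder))"
proof
  show "sets path_borel \<subseteq> sigma_sets UNIV (insert {} (range (cylinder :: 's list \<Rightarrow> _)))"
    unfolding sets_path_borel
    by (intro sigma_sets_mono subsetI, simp, rule open_in_sigma_cylinders)
      (auto intro: sigma_algebra_sigma_sets)
  show "sigma_sets UNIV (insert {} (range cylinder)) \<subseteq> sets (path_borel :: (nat \<Rightarrow> 's) measure)"
    unfolding sets_path_borel
    by (intro sigma_sets_mono) (auto simp: openin_cylinder intro: sigma_sets.Empty)
qed

lemma cylinder_Int:
  assumes "length xs \<le> length ys"
  shows "cylinder xs \<inter> cylinder ys = (if take (length xs) ys = xs then cylinder ys else {})"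
proof (cases "take (length xs) ys = xs")
  case True
  then obtain zs where "ys = xs @ zs" by (metis append_take_drop_id)
  then show ?thesis using True by (auto simp: mem_cylinder_append)
next
  case False
  then obtain k where "k < length xs" "ys ! k \<noteq> xs ! k"
    using assms by (metis (no_types, lifting) length_take min.absorb2 nth_equalityI nth_take)
  then show ?thesis
    using False assms by (auto simp: cylinder_def)
qed

text \<open>Two cylinders are nested or disjoint; the empty set is included for the second
  case.\<close>

lemma Int_stable_cylinders: "Int_stable (insert {} (range cylinder))"
proof (rule Int_stableI)
  have *: "cylinder xs \<inter> cylinder ys \<in> insert {} (range cylinder)"
    if "length xs \<le> length ys" for xs ys :: "'b list"
    using cylinder_Int[OF that] by auto
  have "cylinder xs \<inter> cylinder ys \<in> insert {} (range cylinder)" for xs ys :: "'b list"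
    using *[of xs ys] *[of ys xs] by (cases "length xs \<le> length ys") (auto simp: Int_commute)
  then show "a \<inter> b \<in> insert {} (range cylinder)"
    if "a \<in> insert {} (range cylinder)" "b \<in> insert {} (range cylinder)"
    for a b :: "(nat \<Rightarrow> 'b) set"
    using that by auto
qed

lemma path_probabilitiesD:
  assumes "\<nu> \<in> path_probabilities"
  shows "prob_space \<nu>" "sets \<nu> = sets path_borel" "space \<nu> = UNIV" "cylinder xs \<in> sets \<nu>"
  using assms sets_eq_imp_space_eq[of \<nu> path_borel] by (auto simp: path_probabilities_def)

lemma path_measure_eqI:
  fixes \<mu> \<nu> :: "(nat \<Rightarrow> 's::finite) measure"
  assumes "\<mu> \<in> path_probabilities" "\<nu> \<in> path_probabilities"
    and eq: "\<And>xs. measure \<mu> (cylinder xs) = measure \<nu> (cylinder xs)"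
  shows "\<mu> = \<nu>"
proof -
  interpret \<mu>: prob_space \<mu> using assms(1) by (rule path_probabilitiesD)
  interpret \<nu>: prob_space \<nu> using assms(2) by (rule path_probabilitiesD)
  show ?thesis
  proof (rule measure_eqI_generator_eq[OF Int_stable_cylinders, where A = "\<lambda>_. UNIV"])
    show "emeasure \<mu> X = emeasure \<nu> X" if "X \<in> insert {} (range cylinder)" for X
      using that eq by (auto simp: \<mu>.emeasure_eq_measure \<nu>.emeasure_eq_measure)
    show "range (\<lambda>_. UNIV) \<subseteq> insert {} (range cylinder)"
      by (metis cylinder_Nil insertCI image_subset_iff rangeI)
  qed (use assms path_probabilitiesD(2) sets_path_borel_cylinders in auto)
qed

section \<open>Shift, centrality and invariance\<close>

definition path_shift :: "nat \<Rightarrow> (nat \<Rightarrow> 's) \<Rightarrow> nat \<Rightarrow> 's" where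
  "path_shift n \<omega> k = \<omega> (n + k)"

lemma measurable_path_shift [measurable]: "path_shift n \<in> path_borel \<rightarrow>\<^sub>M path_borel"
  unfolding path_borel_def
proof (rule measurable_measure_of)
  fix U :: "(nat \<Rightarrow> 'a) set" assume "U \<in> {U. openin path_topology U}"
  then have U: "openin path_topology U" by simp
  have "openin path_topology (path_shift n -` U)"
    unfolding openin_path_topology_iff
  proof
    fix \<omega> assume "\<omega> \<in> path_shift n -` U"
    then obtain m where m: "cylinder (map (path_shift n \<omega>) [0..<m]) \<subseteq> U"
      using U unfolding openin_path_topology_iff by blast
    have "cylinder (map \<omega> [0..<n + m]) \<subseteq> path_shift n -` U"
    proof
      fix \<omega>' assume "\<omega>' \<in> cylinder (map \<omega> [0..<n + m])"
      then have "path_shift n \<omega>' \<in> cylinder (map (path_shift n \<omega>) [0..<m])"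
        by (simp only: mem_cylinder_prefix) (simp add: path_shift_def)
      then show "\<omega>' \<in> path_shift n -` U" using m by blast
    qed
    then show "\<exists>n'. cylinder (map \<omega> [0..<n']) \<subseteq> path_shift n -` U" by blast
  qed
  then show "path_shift n -` U \<inter> space (sigma UNIV {U. openin path_topology U}) \<in>
      sets (sigma UNIV {U. openin path_topology U})"
    by (auto simp: space_measure_of_conv intro: sigma_sets.Basic)
qed auto

lemma path_measure_finite_disjoint_UN:
  fixes \<nu> :: "(nat \<Rightarrow> 's) measure" and A :: "'t::finite \<Rightarrow> (nat \<Rightarrow> 's) set"
  assumes \<nu>: "\<nu> \<in> path_probabilities" and A: "\<And>s. A s \<in> sets path_borel"
    and disj: "\<And>s t \<omega>. \<omega> \<in> A s \<Longrightarrow> \<omega> \<in> A t \<Longrightarrow> s = t"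
  shows "measure \<nu> (\<Union>s. A s) = (\<Sum>s\<in>UNIV. measure \<nu> (A s))"
proof -
  interpret prob_space \<nu> using \<nu> by (rule path_probabilitiesD)
  show ?thesis
    using A disj path_probabilitiesD(2)[OF \<nu>]
    by (intro finite_measure_finite_Union) (auto simp: disjoint_family_on_def)
qed

lemma measure_cylinder_snoc:
  fixes \<nu> :: "(nat \<Rightarrow> 's::finite) measure"
  assumes "\<nu> \<in> path_probabilities"
  shows "measure \<nu> (cylinder xs) = (\<Sum>s\<in>UNIV. measure \<nu> (cylinder (xs @ [s])))"
proof -
  have "cylinder xs = (\<Union>s. cylinder (xs @ [s]))"
    by (auto simp: mem_cylinder_append mem_cylinder_Cons)
  moreover have "measure \<nu> (\<Union>s. cylinder (xs @ [s])) =
      (\<Sum>s\<in>UNIV. measure \<nu> (cylinder (xs @ [s])))"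
    by (rule path_measure_finite_disjoint_UN[OF assms cylinder_in_sets])
      (auto simp: mem_cylinder_append mem_cylinder_Cons)
  ultimately show ?thesis by simp
qed

lemma path_end_eq: "path_end S g xs = g + sum_list (map S xs)"
  by (induction xs arbitrary: g) (simp_all add: add.assoc)

text \<open>Length 0 may be included because it only compares the empty word with itself.\<close>

lemma central_measures_iff:
  "\<nu> \<in> central_measures S \<longleftrightarrow> \<nu> \<in> path_probabilities \<and>
    (\<forall>xs ys. length xs = length ys \<longrightarrow> sum_list (map S xs) = sum_list (map S ys) \<longrightarrow>
      measure \<nu> (cylinder xs) = measure \<nu> (cylinder ys))" (is "?L \<longleftrightarrow> ?R")
proof
  assume L: ?L
  have "measure \<nu> (cylinder xs) = measure \<nu> (cylinder ys)"
    if "length xs = length ys" "sum_list (map S xs) = sum_list (map S ys)" for xs ys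
  proof (cases "ys = []")
    case False
    then have "length xs > 0" using that by simp
    have "\<forall>v. \<forall>n>0. \<forall>xs ys. length xs = n \<and> path_end S 0 xs = v \<and>
        length ys = n \<and> path_end S 0 ys = v \<longrightarrow>
        measure \<nu> (cylinder xs) = measure \<nu> (cylinder ys)"
      using L unfolding central_measures_def by simp
    from this[rule_format, OF \<open>length xs > 0\<close>, of xs "sum_list (map S xs)" ys] show ?thesis
      using that by (simp add: path_end_eq)
  qed (use that in simp)
  then show ?R using L unfolding central_measures_def by blast
next
  assume R: ?R
  show ?L
    unfolding central_measures_def path_end_eq add_0
  proof (intro CollectI conjI allI impI)
    fix v n xs ys
    assume "length xs = n \<and> sum_list (map S xs) = v \<and> length ys = n \<and> sum_list (map S ys) = v"
    then have "length xs = length ys" "sum_list (map S xs) = sum_list (map S ys)" by simp_all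
    then show "measure \<nu> (cylinder xs) = measure \<nu> (cylinder ys)" using R by blast
  qed (use R in blast)
qed

lemma central_measuresD:
  assumes "\<nu> \<in> central_measures S"
  shows "\<nu> \<in> path_probabilities"
    "\<And>xs ys. length xs = length ys \<Longrightarrow> sum_list (map S xs) = sum_list (map S ys) \<Longrightarrow>
      measure \<nu> (cylinder xs) = measure \<nu> (cylinder ys)"
  using assms unfolding central_measures_iff by blast+

text \<open>Since the group is commutative, a central measure does not change when letters are permuted;
  so a gap between two words can be moved behind them and summed out.\<close>

lemma central_measure_gap:
  fixes \<nu> :: "(nat \<Rightarrow> 's::finite) measure" and S :: "'s \<Rightarrow> 'a::ab_group_add"
  assumes \<nu>: "\<nu> \<in> central_measures S"
  shows "measure \<nu> (cylinder xs \<inter> path_shift (length xs + n) -` cylinder ys) =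
    measure \<nu> (cylinder (xs @ ys))"
proof (induction n arbitrary: ys)
  case 0
  have "cylinder xs \<inter> path_shift (length xs + 0) -` cylinder ys = cylinder (xs @ ys)"
    by (auto simp: mem_cylinder_append path_shift_def[abs_def])
  then show ?case by simp
next
  case (Suc n)
  note path = central_measuresD(1)[OF \<nu>]
  have shift: "path_shift (length xs + n) \<omega> \<in> cylinder (s # ys) \<longleftrightarrow>
      \<omega> (length xs + n) = s \<and> path_shift (length xs + Suc n) \<omega> \<in> cylinder ys" for \<omega> s
    by (simp add: mem_cylinder_Cons path_shift_def[abs_def])
  have meas: "cylinder xs \<inter> path_shift m -` cylinder zs \<in> sets path_borel" for m zs
    using measurable_sets[OF measurable_path_shift cylinder_in_sets, of m zs] by simp
  \<comment> \<open>Splitting by the last letter of the gap shortens the gap by one and lengthens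
    the second word, which is why the induction generalises \<open>ys\<close>.\<close>
  have "cylinder xs \<inter> path_shift (length xs + Suc n) -` cylinder ys =
      (\<Union>s. cylinder xs \<inter> path_shift (length xs + n) -` cylinder (s # ys))"
    by (auto simp: shift)
  also have "measure \<nu> \<dots> =
      (\<Sum>s\<in>UNIV. measure \<nu> (cylinder xs \<inter> path_shift (length xs + n) -` cylinder (s # ys)))"
    using meas by (intro path_measure_finite_disjoint_UN[OF path]) (auto simp: shift)
  also have "\<dots> = (\<Sum>s\<in>UNIV. measure \<nu> (cylinder (xs @ s # ys)))"
    by (simp only: Suc.IH)
  \<comment> \<open>Commutativity of the group enters here: moving \<open>s\<close> to the end
    leaves the sum of the word unchanged.\<close>
  also have "\<dots> = (\<Sum>s\<in>UNIV. measure \<nu> (cylinder ((xs @ ys) @ [s])))"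
    by (intro sum.cong central_measuresD(2)[OF \<nu>]) (simp_all add: ac_simps)
  also have "\<dots> = measure \<nu> (cylinder (xs @ ys))"
    by (rule measure_cylinder_snoc[OF path, symmetric])
  finally show ?case .
qed

lemma distr_path_shift:
  assumes "\<mu> \<in> path_probabilities"
  shows "distr \<mu> path_borel (path_shift n) \<in> path_probabilities"
    "A \<in> sets path_borel \<Longrightarrow>
      measure (distr \<mu> path_borel (path_shift n)) A = measure \<mu> (path_shift n -` A)"
proof -
  have m: "path_shift n \<in> \<mu> \<rightarrow>\<^sub>M path_borel"
    using measurable_path_shift measurable_cong_sets[OF path_probabilitiesD(2)[OF assms] refl] by blast
  then show "distr \<mu> path_borel (path_shift n) \<in> path_probabilities"
    using prob_space.prob_space_distr[OF path_probabilitiesD(1)[OF assms]]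
    by (simp add: path_probabilities_def)
  show "measure (distr \<mu> path_borel (path_shift n)) A = measure \<mu> (path_shift n -` A)"
    if "A \<in> sets path_borel"
    using measure_distr[OF m that] path_probabilitiesD(3)[OF assms] by simp
qed

text \<open>With an empty first word, the gap formula says that the shifted measure agrees with
  \<open>\<nu>\<close> on all cylinders.\<close>

lemma central_measure_shift_invariant:
  fixes \<nu> :: "(nat \<Rightarrow> 's::finite) measure"
  assumes \<nu>: "\<nu> \<in> central_measures S" and A: "A \<in> sets path_borel"
  shows "measure \<nu> (path_shift n -` A) = measure \<nu> A"
proof -
  note path = central_measuresD(1)[OF \<nu>]
  have "distr \<nu> path_borel (path_shift n) = \<nu>"
    using central_measure_gap[OF \<nu>, of "[]" n]
    by (intro path_measure_eqI distr_path_shift path) (simp add: distr_path_shift[OF path])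
  then show ?thesis
    using distr_path_shift(2)[OF path A, of n] by simp
qed

text \<open>Variance of the empirical frequency: it is nonnegative for every sample size.\<close>

lemma (in prob_space) square_le_pair_probability:
  fixes A :: "nat \<Rightarrow> 'a set"
  assumes A [measurable]: "\<And>i. A i \<in> events"
    and a: "\<And>i. prob (A i) = a" and b: "\<And>i j. i < j \<Longrightarrow> prob (A i \<inter> A j) = b"
  shows "a\<^sup>2 \<le> b"
proof -
  have pair: "prob (A i \<inter> A j) = (if i = j then a else b)" for i j
    using a b[of i j] b[of j i] by (cases i j rule: linorder_cases) (auto simp: Int_commute)
  have int: "integrable M (\<lambda>x. indicat_real (A i) x)" for i
    by (intro integrable_real_indicator) (auto simp: emeasure_eq_measure)
  have int2: "integrable M (\<lambda>x. indicat_real (A i \<inter> A j) x)" for i j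
    by (intro integrable_real_indicator) (auto simp: emeasure_eq_measure)
  \<comment> \<open>The right-hand side is the second moment about \<open>n * a\<close> of the
    number of events that occur among the first \<open>n\<close>: the \<open>n\<close> diagonal
    pairs contribute \<open>a\<close>, all other ordered pairs \<open>b\<close>.\<close>
  have ineq: "0 \<le> real n * (a - b) + (real n)\<^sup>2 * (b - a\<^sup>2)" for n
  proof -
    have "0 \<le> (\<integral>x. ((\<Sum>i<n. indicator (A i) x) - real n * a)\<^sup>2 \<partial>M)"
      by simp
    also have "\<dots> = (\<integral>x. (\<Sum>i<n. \<Sum>j<n. indicator (A i \<inter> A j) x)
        - 2 * real n * a * (\<Sum>i<n. indicator (A i) x) + (real n * a)\<^sup>2 \<partial>M)"
      by (simp add: power2_diff power2_eq_square[of "sum _ _"] sum_product indicator_inter_arith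
          algebra_simps)
    also have "\<dots> = (\<Sum>i<n. \<Sum>j<n. prob (A i \<inter> A j)) - 2 * real n * a * (\<Sum>i<n. prob (A i))
        + (real n * a)\<^sup>2"
      by (simp add: int int2 prob_space)
    also have "(\<Sum>i<n. \<Sum>j<n. prob (A i \<inter> A j)) = (\<Sum>i<n. \<Sum>j<n. b + (if i = j then a - b else 0))"
      by (intro sum.cong) (auto simp: pair)
    also have "\<dots> = real n * (real n * b + (a - b))"
      by (simp add: sum.distrib)
    finally show ?thesis
      by (simp add: a power2_eq_square algebra_simps)
  qed
  show ?thesis
  proof (rule ccontr)
    assume "\<not> a\<^sup>2 \<le> b"
    then have pos: "0 < a\<^sup>2 - b" by simp
    obtain n :: nat where n: "(a - b) / (a\<^sup>2 - b) < real n"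
      using reals_Archimedean2 by blast
    then have "a - b < real (Suc n) * (a\<^sup>2 - b)"
      using pos by (simp add: field_simps)
    \<comment> \<open>\<open>Suc n\<close> replaces \<open>n\<close> to have a positive factor; for
      large \<open>n\<close> the negative quadratic term dominates.\<close>
    then have "real (Suc n) * (a - b) < real (Suc n) * (real (Suc n) * (a\<^sup>2 - b))"
      by (intro mult_strict_left_mono) auto
    with ineq[of "Suc n"] show False
      by (simp add: power2_eq_square algebra_simps)
  qed
qed

text \<open>The events are the occurrences of \<open>xs\<close> in successive blocks of its own
  length. Two occurrences are separated by some gap, which the gap formula closes, so every pair has
  the probability of the doubled word.\<close>

lemma central_measure_square_le:
  fixes \<nu> :: "(nat \<Rightarrow> 's::finite) measure"
  assumes \<nu>: "\<nu> \<in> central_measures S"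
  shows "(measure \<nu> (cylinder xs))\<^sup>2 \<le> measure \<nu> (cylinder (xs @ xs))"
proof -
  note path = central_measuresD(1)[OF \<nu>]
  interpret prob_space \<nu> using path by (rule path_probabilitiesD)
  define A where "A i = path_shift (i * length xs) -` cylinder xs" for i
  have A: "A i \<in> sets path_borel" for i
    using measurable_sets[OF measurable_path_shift cylinder_in_sets, of "i * length xs" xs]
    by (simp add: A_def)
  show ?thesis
  proof (rule square_le_pair_probability[of A])
    show "A i \<in> events" for i using A path_probabilitiesD(2)[OF path] by simp
    show "prob (A i) = prob (cylinder xs)" for i
      unfolding A_def by (rule central_measure_shift_invariant[OF \<nu> cylinder_in_sets])
    show "prob (A i \<inter> A j) = prob (cylinder (xs @ xs))" if "i < j" for i j
    proof -
      obtain m where j: "j = i + Suc m" using less_imp_Suc_add[OF \<open>i < j\<close>] by auto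
      have "A i \<inter> A j = path_shift (i * length xs) -`
          (cylinder xs \<inter> path_shift (length xs + m * length xs) -` cylinder xs)"
        by (auto simp: A_def j path_shift_def[abs_def] algebra_simps)
      also have "prob \<dots> = prob (cylinder xs \<inter> path_shift (length xs + m * length xs) -` cylinder xs)"
        using A[of "Suc m"] by (intro central_measure_shift_invariant[OF \<nu>]) (simp add: A_def)
      also have "\<dots> = prob (cylinder (xs @ xs))"
        by (rule central_measure_gap[OF \<nu>])
      finally show ?thesis .
    qed
  qed
qed

section \<open>The absolute\<close>

text \<open>The law of independent letters with distribution \<open>p\<close>. Pushing forward along
  the identity only exchanges the product sigma-algebra for the Borel one.\<close>

definition bernoulli_measure :: "real ^ 's::finite \<Rightarrow> (nat \<Rightarrow> 's) measure" where
  "bernoulli_measure p =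
    distr (Pi\<^sub>M UNIV (\<lambda>_. measure_pmf (embed_pmf (($) p)))) path_borel (\<lambda>\<omega>. \<omega>)"

lemma bernoulli_measure:
  fixes p :: "real ^ 's::finite"
  assumes p: "p \<in> prob_simplex"
  shows "bernoulli_measure p \<in> path_probabilities"
    and "measure (bernoulli_measure p) (cylinder xs) = word_weight p xs"
proof -
  define P where "P = embed_pmf (($) p)"
  have nonneg: "0 \<le> p $ s" for s using p by (simp add: prob_simplex_def)
  have "(\<integral>\<^sup>+s. ennreal (p $ s) \<partial>count_space UNIV) = 1"
    using p by (simp add: nn_integral_count_space_finite sum_ennreal prob_simplex_def)
  then have pmf_P: "pmf P s = p $ s" for s
    unfolding P_def by (intro pmf_embed_pmf nonneg)
  interpret product_prob_space "\<lambda>_::nat. measure_pmf P" UNIV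
    by unfold_locales
  let ?PiM = "Pi\<^sub>M (UNIV :: nat set) (\<lambda>_. measure_pmf P)"
  have cyl: "cylinder xs = {\<omega> \<in> space ?PiM. \<forall>k\<in>{..<length xs}. \<omega> k \<in> {xs ! k}}" for xs
    by (auto simp: cylinder_def space_PiM)
  have cyl_sets: "cylinder xs \<in> sets ?PiM" for xs
    unfolding cyl by measurable
  have id: "(\<lambda>\<omega>. \<omega>) \<in> ?PiM \<rightarrow>\<^sub>M path_borel"
    using cyl_sets
    by (intro measurable_sigma_sets[OF sets_path_borel_cylinders]) (auto simp: space_PiM)
  show "bernoulli_measure p \<in> path_probabilities"
    using P.prob_space_distr[OF id]
    by (simp add: bernoulli_measure_def P_def path_probabilities_def)
  have "measure (bernoulli_measure p) (cylinder xs) = measure ?PiM (cylinder xs)"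
    using measure_distr[OF id cylinder_in_sets, of xs]
    by (simp add: bernoulli_measure_def P_def space_PiM)
  also have "emeasure ?PiM (cylinder xs) = (\<Prod>k<length xs. ennreal (p $ (xs ! k)))"
    unfolding cyl by (subst emeasure_PiM_Collect) (simp_all add: emeasure_pmf_single pmf_P)
  then have "measure ?PiM (cylinder xs) = (\<Prod>k<length xs. p $ (xs ! k))"
    by (simp add: measure_def prod_ennreal nonneg prod_nonneg)
  also have "\<dots> = word_weight p xs"
    by (simp add: word_weight_def prod.list_conv_set_nth atLeast0LessThan)
  finally show "measure (bernoulli_measure p) (cylinder xs) = word_weight p xs" .
qed

definition letter_weights :: "(nat \<Rightarrow> 's) measure \<Rightarrow> real ^ 's::finite" where
  "letter_weights \<nu> = (\<chi> s. measure \<nu> (cylinder [s]))"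

lemma letter_weights_bernoulli_measure:
  "p \<in> prob_simplex \<Longrightarrow> letter_weights (bernoulli_measure p) = p"
  by (simp add: letter_weights_def bernoulli_measure vec_eq_iff)

lemma letter_weights_in_prob_simplex:
  assumes "\<nu> \<in> path_probabilities"
  shows "letter_weights \<nu> \<in> prob_simplex"
proof -
  interpret prob_space \<nu> using assms by (rule path_probabilitiesD)
  show ?thesis
    using measure_cylinder_snoc[OF assms, of "[]"] prob_space path_probabilitiesD(3)[OF assms]
    by (simp add: letter_weights_def prob_simplex_def)
qed

text \<open>A central measure is a mixture of its conditionings on the first letter being \<open>s\<close> or not,
  each followed by the shift. Extremality makes the two agree, so letters are independent.\<close>

lemma absolute_multiplicative:
  fixes S :: "'s::finite \<Rightarrow> 'a::ab_group_add"
  assumes \<nu>: "\<nu> \<in> absolute S"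
  shows "measure \<nu> (cylinder (s # xs)) = measure \<nu> (cylinder [s]) * measure \<nu> (cylinder xs)"
proof -
  have extreme: "extreme_measure \<nu> (central_measures S)"
    using \<nu> by (simp add: absolute_def)
  then have central: "\<nu> \<in> central_measures S" by (simp add: extreme_measure_def)
  note path = central_measuresD(1)[OF central]
  interpret prob_space \<nu> using path by (rule path_probabilitiesD)
  have sets: "events = sets path_borel" and space: "space \<nu> = UNIV"
    using path_probabilitiesD[OF path] by auto
  define X where "X = (cylinder [s] :: (nat \<Rightarrow> 's) set)"
  have X: "X \<in> events" "- X \<in> events"
    using sets.compl_sets[of X \<nu>] by (auto simp: X_def sets space Compl_eq_Diff_UNIV)
  have X_shift: "X \<inter> path_shift (Suc 0) -` cylinder zs = cylinder (s # zs)" for zs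
    by (auto simp: X_def mem_cylinder_Cons path_shift_def[abs_def])
  have vimage: "path_shift (Suc 0) -` A \<in> events" if "A \<in> sets path_borel" for A
    using measurable_sets[OF measurable_path_shift that, of "Suc 0"] by (simp add: sets)
  have split: "prob (- X \<inter> path_shift (Suc 0) -` A) = prob A - prob (X \<inter> path_shift (Suc 0) -` A)"
    if "A \<in> sets path_borel" for A
  proof -
    have "prob (path_shift (Suc 0) -` A - X) = prob (path_shift (Suc 0) -` A) - prob (path_shift (Suc 0) -` A \<inter> X)"
      using vimage[OF that] X by (intro finite_measure_Diff')
    moreover have "path_shift (Suc 0) -` A - X = - X \<inter> path_shift (Suc 0) -` A" by blast
    ultimately show ?thesis
      by (simp add: central_measure_shift_invariant[OF central that] Int_commute)
  qed
  define q where "q = prob X"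
  have compl: "prob (- X) = 1 - q"
    using prob_compl[OF X(1)] by (simp add: q_def space Compl_eq_Diff_UNIV)
  have sub: "prob (cylinder (s # xs)) \<le> q"
    unfolding X_shift[symmetric] q_def using X by (intro finite_measure_mono) auto
  \<comment> \<open>For \<open>q\<close> equal to 0 or 1 one of the two conditionings is undefined,
    and monotonicity gives the product formula directly.\<close>
  consider "q = 0" | "q = 1" | "0 < q" "q < 1"
    unfolding q_def using prob_le_1[of X] measure_nonneg[of \<nu> X] by linarith
  then have "prob (cylinder (s # xs)) = q * prob (cylinder xs)"
  proof cases
    case 1
    then show ?thesis using sub measure_nonneg[of \<nu> "cylinder (s # xs)"] by simp
  next
    case 2
    have "prob (- X \<inter> path_shift (Suc 0) -` cylinder xs) \<le> prob (- X)"
      using X by (intro finite_measure_mono) auto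
    then have "prob (- X \<inter> path_shift (Suc 0) -` cylinder xs) = 0"
      using compl 2 by (simp add: measure_le_0_iff)
    then show ?thesis
      using split[OF cylinder_in_sets, of xs] 2 by (simp add: X_shift)
  next
    case 3
    define \<kappa> where "\<kappa> E = distr (uniform_measure \<nu> E) path_borel (path_shift (Suc 0))" for E
    have \<kappa>: "\<kappa> E \<in> path_probabilities"
      "\<And>A. A \<in> sets path_borel \<Longrightarrow> measure (\<kappa> E) A = prob (E \<inter> path_shift (Suc 0) -` A) / prob E"
      if E: "E \<in> events" "prob E \<noteq> 0" for E
    proof -
      have "uniform_measure \<nu> E \<in> path_probabilities"
        using E by (auto simp: path_probabilities_def sets emeasure_eq_measure
            intro!: prob_space_uniform_measure)
      then show "\<kappa> E \<in> path_probabilities"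
        "\<And>A. A \<in> sets path_borel \<Longrightarrow> measure (\<kappa> E) A = prob (E \<inter> path_shift (Suc 0) -` A) / prob E"
        using E vimage by (simp_all add: \<kappa>_def distr_path_shift emeasure_eq_measure)
    qed
    have \<kappa>X: "measure (\<kappa> X) (cylinder zs) = prob (cylinder (s # zs)) / q" for zs
      using \<kappa>(2)[OF X(1) _ cylinder_in_sets] 3 by (simp add: X_shift q_def)
    have \<kappa>X': "measure (\<kappa> (- X)) (cylinder zs) =
        (prob (cylinder zs) - prob (cylinder (s # zs))) / (1 - q)" for zs
      using \<kappa>(2)[OF X(2) _ cylinder_in_sets] 3 compl
      by (simp add: split[OF cylinder_in_sets] X_shift)
    \<comment> \<open>A common first letter preserves equality of lengths and sums; this makes both
      conditionings central.\<close>
    have cent: "prob (cylinder (s # xs)) = prob (cylinder (s # ys)) \<and>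
        prob (cylinder xs) = prob (cylinder ys)"
      if "length xs = length ys" "sum_list (map S xs) = sum_list (map S ys)" for xs ys
      using that by (intro conjI central_measuresD(2)[OF central]) simp_all
    have "\<kappa> X \<in> central_measures S"
      unfolding central_measures_iff
    proof (intro conjI allI impI)
      fix xs ys :: "'s list"
      assume "length xs = length ys" "sum_list (map S xs) = sum_list (map S ys)"
      from cent[OF this] show "measure (\<kappa> X) (cylinder xs) = measure (\<kappa> X) (cylinder ys)"
        by (simp add: \<kappa>X)
    qed (use \<kappa>(1)[OF X(1)] 3 in \<open>simp add: q_def\<close>)
    moreover have "\<kappa> (- X) \<in> central_measures S"
      unfolding central_measures_iff
    proof (intro conjI allI impI)
      fix xs ys :: "'s list"
      assume "length xs = length ys" "sum_list (map S xs) = sum_list (map S ys)"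
      from cent[OF this]
      show "measure (\<kappa> (- X)) (cylinder xs) = measure (\<kappa> (- X)) (cylinder ys)"
        by (simp add: \<kappa>X')
    qed (use \<kappa>(1)[OF X(2)] 3 compl in simp)
    \<comment> \<open>The weight \<open>q\<close> is written so as to match
      \<open>extreme_measure\<close> with \<open>t = 1 - q\<close>. The mixture is the law of the
      shifted path, which is \<open>\<nu>\<close> by the invariance contained in
      \<open>split\<close>.\<close>
    moreover have "prob A = (1 - (1 - q)) * measure (\<kappa> X) A + (1 - q) * measure (\<kappa> (- X)) A"
      if "A \<in> events" for A
      using that \<kappa>(2)[OF X(1)] \<kappa>(2)[OF X(2)] split 3 compl by (simp add: sets q_def[symmetric])
    ultimately have "\<kappa> X = \<kappa> (- X)"
      using extreme 3 unfolding extreme_measure_def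
      by (metis diff_gt_0_iff_gt diff_less_eq less_add_same_cancel1)
    then have "prob (cylinder (s # xs)) / q =
        (prob (cylinder xs) - prob (cylinder (s # xs))) / (1 - q)"
      by (metis \<kappa>X \<kappa>X')
    then show ?thesis using 3 by (simp add: field_simps)
  qed
  then show ?thesis by (simp add: q_def X_def)
qed

lemma bernoulli_measure_central:
  assumes "p \<in> central_weights S"
  shows "bernoulli_measure p \<in> central_measures S"
  unfolding central_measures_iff
proof (intro conjI allI impI)
  fix xs ys assume "length xs = length ys" "sum_list (map S xs) = sum_list (map S ys)"
  from central_weightsD(4)[OF assms this]
  show "measure (bernoulli_measure p) (cylinder xs) = measure (bernoulli_measure p) (cylinder ys)"
    by (simp add: bernoulli_measure(2)[OF central_weightsD(1)[OF assms]])
qed (rule bernoulli_measure(1)[OF central_weightsD(1)[OF assms]])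

text \<open>The square of a cylinder probability is at most the probability of the doubled word, with
  equality for Bernoulli measures; strict convexity of the square leaves no room for mixtures.\<close>

lemma bernoulli_measure_in_absolute:
  fixes S :: "'s::finite \<Rightarrow> 'a::ab_group_add"
  assumes p: "p \<in> central_weights S"
  shows "bernoulli_measure p \<in> absolute S"
  unfolding absolute_def mem_Collect_eq extreme_measure_def
proof (intro conjI ballI allI impI)
  show "bernoulli_measure p \<in> central_measures S"
    using p by (rule bernoulli_measure_central)
  note path = central_measuresD(1)[OF this]
  fix \<mu>\<^sub>1 \<mu>\<^sub>2 :: "(nat \<Rightarrow> 's) measure" and t :: real
  assume \<mu>: "\<mu>\<^sub>1 \<in> central_measures S" "\<mu>\<^sub>2 \<in> central_measures S"
    and "0 < t \<and> t < 1 \<and> (\<forall>A\<in>sets (bernoulli_measure p).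
      measure (bernoulli_measure p) A = (1 - t) * measure \<mu>\<^sub>1 A + t * measure \<mu>\<^sub>2 A)"
  then have t: "0 < t" "t < 1" and mix: "word_weight p xs =
      (1 - t) * measure \<mu>\<^sub>1 (cylinder xs) + t * measure \<mu>\<^sub>2 (cylinder xs)" for xs
    using path_probabilitiesD(4)[OF path]
    by (simp_all add: bernoulli_measure(2)[OF central_weightsD(1)[OF p], symmetric])
  show "\<mu>\<^sub>1 = \<mu>\<^sub>2"
  proof (rule path_measure_eqI)
    fix xs :: "'s list"
    define a b where "a = measure \<mu>\<^sub>1 (cylinder xs)" and "b = measure \<mu>\<^sub>2 (cylinder xs)"
    have "(1 - t) * a\<^sup>2 + t * b\<^sup>2 \<le> word_weight p (xs @ xs)"
      unfolding mix a_def b_def using t \<mu>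
      by (intro add_mono mult_left_mono central_measure_square_le) auto
    also have "\<dots> = ((1 - t) * a + t * b)\<^sup>2"
      by (simp add: word_weight_append mix a_def b_def power2_eq_square)
    \<comment> \<open>This is the gap in Jensen's inequality for the square at the two points
      \<open>a\<close> and \<open>b\<close>.\<close>
    finally have "t * (1 - t) * (a - b)\<^sup>2 \<le> 0"
      by (simp add: power2_eq_square algebra_simps)
    moreover have "0 < t * (1 - t)" using t by simp
    ultimately have "(a - b)\<^sup>2 \<le> 0"
      by (metis mult_pos_pos not_le)
    then show "measure \<mu>\<^sub>1 (cylinder xs) = measure \<mu>\<^sub>2 (cylinder xs)"
      by (simp add: a_def b_def)
  qed (use \<mu> central_measuresD(1) in auto)
qed

lemma absolute_bernoulli:
  fixes S :: "'s::finite \<Rightarrow> 'a::ab_group_add"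
  assumes \<nu>: "\<nu> \<in> absolute S"
  shows "letter_weights \<nu> \<in> central_weights S" "bernoulli_measure (letter_weights \<nu>) = \<nu>"
proof -
  have central: "\<nu> \<in> central_measures S"
    using \<nu> by (simp add: absolute_def extreme_measure_def)
  note path = central_measuresD(1)[OF central]
  interpret prob_space \<nu> using path by (rule path_probabilitiesD)
  have simplex: "letter_weights \<nu> \<in> prob_simplex"
    by (rule letter_weights_in_prob_simplex[OF path])
  have weight: "word_weight (letter_weights \<nu>) xs = prob (cylinder xs)" for xs
  proof (induction xs)
    case Nil
    show ?case using prob_space path_probabilitiesD(3)[OF path] by simp
  next
    case (Cons s xs)
    then show ?case
      using absolute_multiplicative[OF \<nu>, of s xs] by (simp add: letter_weights_def)
  qed
  show "letter_weights \<nu> \<in> central_weights S"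
    unfolding central_weights_def
  proof (intro CollectI conjI allI impI simplex)
    fix xs ys assume "length xs = length ys" "sum_list (map S xs) = sum_list (map S ys)"
    then show "word_weight (letter_weights \<nu>) xs = word_weight (letter_weights \<nu>) ys"
      unfolding weight by (rule central_measuresD(2)[OF central])
  qed
  show "bernoulli_measure (letter_weights \<nu>) = \<nu>"
    by (intro path_measure_eqI path bernoulli_measure simplex)
      (simp add: bernoulli_measure(2)[OF simplex] weight)
qed

section \<open>The weak topology and the identification with weights\<close>

lemma weak_topology_generator:
  "{\<nu> \<in> path_probabilities. (\<integral>\<omega>. f \<omega> \<partial>\<nu>) \<in> U} \<in>
    {{\<nu> \<in> path_probabilities. (\<integral>\<omega>. f \<omega> \<partial>\<nu>) \<in> U} | f U.
      continuous_map path_topology euclideanreal f \<and> bounded (range f) \<and> open U}"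
  if "continuous_map path_topology euclideanreal f" "bounded (range f)" "open U"
  using that by blast

lemma topspace_weak_topology: "topspace weak_topology = path_probabilities"
proof
  show "topspace weak_topology \<subseteq> path_probabilities"
    unfolding weak_topology_def topology_generated_by_topspace by blast
  show "path_probabilities \<subseteq> topspace weak_topology"
    using weak_topology_generator[of "\<lambda>_. 0" UNIV]
    unfolding weak_topology_def topology_generated_by_topspace by auto
qed

lemma continuous_map_weak_integral:
  assumes "continuous_map path_topology euclideanreal f" "bounded (range f)"
  shows "continuous_map weak_topology euclideanreal (\<lambda>\<nu>. \<integral>\<omega>. f \<omega> \<partial>\<nu>)"
  unfolding continuous_map_def topspace_weak_topology
proof (intro conjI allI impI)
  fix U :: "real set" assume "openin euclideanreal U"
  then have "open U" by simp
  then show "openin weak_topology {\<nu> \<in> path_probabilities. (\<integral>\<omega>. f \<omega> \<partial>\<nu>) \<in> U}"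
    unfolding weak_topology_def
    by (intro topology_generated_by_Basis weak_topology_generator assms)
qed auto

lemma continuous_map_finitely_many_coordinates:
  assumes "\<And>\<omega> \<omega>'. (\<forall>k<n. \<omega> k = \<omega>' k) \<Longrightarrow> f \<omega> = f \<omega>'"
  shows "continuous_map path_topology euclideanreal f"
  unfolding continuous_map_def topspace_path_topology
proof (intro conjI allI impI)
  fix U :: "real set"
  show "openin path_topology {\<omega> \<in> UNIV. f \<omega> \<in> U}"
  proof (rule openin_path_topology_finitely_many_coordinates)
    fix \<omega> \<omega>' assume "\<forall>k<n. \<omega> k = \<omega>' k" "\<omega> \<in> {\<omega> \<in> UNIV. f \<omega> \<in> U}"
    then show "\<omega>' \<in> {\<omega> \<in> UNIV. f \<omega> \<in> U}" using assms[of \<omega> \<omega>'] by simp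
  qed
qed auto

text \<open>The indicator of a cylinder depends on finitely many letters, so it is itself an
  admissible test function.\<close>

lemma continuous_map_letter_weights:
  "continuous_map weak_topology euclidean (letter_weights :: _ \<Rightarrow> real ^ 's::finite)"
proof -
  have "continuous_map weak_topology euclideanreal (\<lambda>\<nu>. \<integral>\<omega>. indicator (cylinder [s]) \<omega> \<partial>\<nu>)" for s :: 's
  proof (rule continuous_map_weak_integral)
    show "continuous_map path_topology euclideanreal (indicator (cylinder [s]))"
      by (rule continuous_map_finitely_many_coordinates[of 1])
        (auto simp: cylinder_def indicator_def)
    show "bounded (range (indicat_real (cylinder [s])))"
      by (rule bounded_subset[of "{0, 1}"]) (auto simp: indicator_def)
  qed
  moreover have "(\<integral>\<omega>. indicator (cylinder [s]) \<omega> \<partial>\<nu>) = measure \<nu> (cylinder [s])"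
    if "\<nu> \<in> topspace weak_topology" for \<nu> and s :: 's
    using path_probabilitiesD(3)[of \<nu>] that by (simp add: topspace_weak_topology)
  ultimately have cont: "continuous_map weak_topology euclideanreal (\<lambda>\<nu>. measure \<nu> (cylinder [s]))"
    for s :: 's
    by (metis (no_types, lifting) continuous_map_eq)
  have "continuous_map weak_topology euclidean
      (\<lambda>\<nu>. measure \<nu> (cylinder [s]) *\<^sub>R axis s (1::real))" for s :: 's
  proof -
    have "continuous_map euclideanreal euclidean (\<lambda>r. r *\<^sub>R axis s (1::real))"
      by (auto intro!: continuous_intros)
    from continuous_map_compose[OF cont[of s] this] show ?thesis by (simp add: o_def)
  qed
  then have "continuous_map weak_topology euclidean
      (\<lambda>\<nu>. \<Sum>s\<in>UNIV. measure \<nu> (cylinder [s]) *\<^sub>R axis (s::'s) (1::real))"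
    by (intro continuous_map_sum) auto
  moreover have "(\<lambda>\<nu>. \<Sum>s\<in>UNIV. measure \<nu> (cylinder [s]) *\<^sub>R axis (s::'s) (1::real)) = letter_weights"
    by (auto simp: letter_weights_def vec_eq_iff axis_def if_distrib cong: if_cong)
  ultimately show ?thesis by simp
qed

lemma compact_path_topology: "compact_space (path_topology :: (nat \<Rightarrow> 's::finite) topology)"
  unfolding path_topology_def
  by (simp add: compact_space_product_topology compact_space_discrete_topology)

text \<open>All letters from position \<open>n\<close> on become one fixed letter, so that a
  function of the truncated path depends on finitely many letters.\<close>

definition truncate_path :: "nat \<Rightarrow> (nat \<Rightarrow> 's) \<Rightarrow> nat \<Rightarrow> 's" where
  "truncate_path n \<omega> k = (if k < n then \<omega> k else undefined)"

text \<open>Uniform continuity from compactness: finitely many cylinders, on each of which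
  \<open>f\<close> stays within \<open>e / 2\<close> of one value, cover the space. Truncation
  beyond the longest of their prefixes does not leave them.\<close>

lemma truncate_path_uniform:
  fixes f :: "(nat \<Rightarrow> 's::finite) \<Rightarrow> real"
  assumes f: "continuous_map path_topology euclideanreal f" and e: "0 < e"
  shows "\<exists>N. \<forall>n\<ge>N. \<forall>\<omega>. \<bar>f (truncate_path n \<omega>) - f \<omega>\<bar> < e"
proof -
  have "\<exists>m. \<forall>\<omega>'\<in>cylinder (map \<omega> [0..<m]). \<bar>f \<omega>' - f \<omega>\<bar> < e / 2" for \<omega>
  proof -
    have "openin path_topology {\<omega>' \<in> topspace path_topology. f \<omega>' \<in> ball (f \<omega>) (e / 2)}"
      by (rule openin_continuous_map_preimage[OF f]) simp
    moreover have "\<omega> \<in> {\<omega>' \<in> topspace path_topology. f \<omega>' \<in> ball (f \<omega>) (e / 2)}"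
      using e by simp
    ultimately obtain m where
      "cylinder (map \<omega> [0..<m]) \<subseteq> {\<omega>' \<in> topspace path_topology. f \<omega>' \<in> ball (f \<omega>) (e / 2)}"
      unfolding openin_path_topology_iff by blast
    then have "\<forall>\<omega>'\<in>cylinder (map \<omega> [0..<m]). f \<omega>' \<in> ball (f \<omega>) (e / 2)"
      by blast
    then show ?thesis
      by (auto simp: dist_real_def abs_minus_commute)
  qed
  then obtain m where m:
    "\<And>\<omega> \<omega>'. \<omega>' \<in> cylinder (map \<omega> [0..<m \<omega>]) \<Longrightarrow> \<bar>f \<omega>' - f \<omega>\<bar> < e / 2"
    by metis
  define C where "C \<omega> = cylinder (map \<omega> [0..<m \<omega>])" for \<omega>
  have "\<exists>F. finite F \<and> F \<subseteq> range C \<and> topspace path_topology \<subseteq> \<Union>F"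
    using compact_path_topology unfolding compact_space_alt
  proof (elim allE impE)
    show "(\<forall>U\<in>range C. openin path_topology U) \<and> topspace path_topology \<subseteq> \<Union>(range C)"
      by (auto simp: C_def openin_cylinder) (metis mem_cylinder_prefix)
  qed auto
  then obtain T where T: "finite T" "UNIV \<subseteq> \<Union>(C ` T)"
    by (metis finite_subset_image topspace_path_topology)
  show ?thesis
  proof (intro exI allI impI)
    fix n \<omega> assume n: "Max (m ` T) \<le> n"
    obtain \<tau> where \<tau>: "\<tau> \<in> T" "\<omega> \<in> C \<tau>" using T(2) by blast
    have "m \<tau> \<le> n" using T(1) \<tau>(1) n by (meson Max_ge finite_imageI image_eqI le_trans)
    then have "truncate_path n \<omega> \<in> C \<tau>"
      using \<tau>(2) unfolding C_def mem_cylinder_prefix truncate_path_def by simp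
    with \<tau>(2) have "\<bar>f (truncate_path n \<omega>) - f \<tau>\<bar> < e / 2" "\<bar>f \<omega> - f \<tau>\<bar> < e / 2"
      unfolding C_def by (blast intro: m)+
    then show "\<bar>f (truncate_path n \<omega>) - f \<omega>\<bar> < e" by linarith
  qed
qed

lemma measurable_path_topology:
  assumes "continuous_map path_topology euclideanreal f"
  shows "f \<in> borel_measurable path_borel"
proof (rule borel_measurableI)
  fix U :: "real set" assume "open U"
  then have "openin path_topology {\<omega> \<in> topspace path_topology. f \<omega> \<in> U}"
    using openin_continuous_map_preimage[OF assms] by simp
  then show "f -` U \<inter> space path_borel \<in> sets path_borel"
    by (auto simp: sets_path_borel vimage_def intro: sigma_sets.Basic)
qed

lemma integral_truncate_path:
  fixes \<nu> :: "(nat \<Rightarrow> 's::finite) measure"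
  assumes "\<nu> \<in> path_probabilities"
  shows "(\<integral>\<omega>. f (truncate_path n \<omega>) \<partial>\<nu>) = (\<Sum>w | length w = n.
    f (\<lambda>k. if k < n then w ! k else undefined) * measure \<nu> (cylinder w))"
proof -
  interpret prob_space \<nu> using assms by (rule path_probabilitiesD)
  note [simp] = path_probabilitiesD(3,4)[OF assms]
  have fin: "finite {w :: 's list. length w = n}"
    using finite_lists_length_eq[of "UNIV :: 's set" n] by simp
  have "f (truncate_path n \<omega>) = (\<Sum>w | length w = n.
      f (\<lambda>k. if k < n then w ! k else undefined) * indicator (cylinder w) \<omega>)" for \<omega>
  proof -
    have "(\<Sum>w | length w = n. f (\<lambda>k. if k < n then w ! k else undefined) * indicator (cylinder w) \<omega>) =
        (\<Sum>w\<in>{map \<omega> [0..<n]}. f (\<lambda>k. if k < n then w ! k else undefined) * indicator (cylinder w) \<omega>)"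
    proof (rule sum.mono_neutral_right[OF fin])
      show "\<forall>w\<in>{w. length w = n} - {map \<omega> [0..<n]}.
          f (\<lambda>k. if k < n then w ! k else undefined) * indicator (cylinder w) \<omega> = 0"
      proof
        fix w assume w: "w \<in> {w. length w = n} - {map \<omega> [0..<n]}"
        have "\<omega> \<notin> cylinder w"
        proof
          assume "\<omega> \<in> cylinder w"
          then have "w = map \<omega> [0..<n]"
            using w by (intro nth_equalityI) (simp_all add: cylinder_def)
          then show False using w by blast
        qed
        then show "f (\<lambda>k. if k < n then w ! k else undefined) * indicator (cylinder w) \<omega> = 0"
          by simp
      qed
    qed simp
    also have "\<dots> = f (\<lambda>k. if k < n then map \<omega> [0..<n] ! k else undefined)"
      by (subst sum.insert) (simp_all add: mem_cylinder_prefix)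
    also have "(\<lambda>k. if k < n then map \<omega> [0..<n] ! k else undefined) = truncate_path n \<omega>"
      by (auto simp: truncate_path_def)
    finally show ?thesis ..
  qed
  moreover have "integrable \<nu> (\<lambda>\<omega>. indicat_real (cylinder w) \<omega>)" for w
    by (intro integrable_real_indicator) (auto simp: emeasure_eq_measure)
  ultimately show ?thesis
    by (simp only: Bochner_Integration.integral_sum integrable_mult_right
      integral_mult_right_zero integral_indicator) simp
qed

text \<open>For truncated paths the integral is a polynomial in \<open>p\<close>. The truncation
  error is bounded uniformly over paths, hence uniformly over all these measures.\<close>

lemma continuous_on_bernoulli_integral:
  fixes f :: "(nat \<Rightarrow> 's::finite) \<Rightarrow> real"
  assumes f: "continuous_map path_topology euclideanreal f" "bounded (range f)"
  shows "continuous_on prob_simplex (\<lambda>p. \<integral>\<omega>. f \<omega> \<partial>bernoulli_measure p)"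
proof (rule uniform_limit_theorem)
  define g where "g n p = (\<integral>\<omega>. f (truncate_path n \<omega>) \<partial>bernoulli_measure p)" for n p
  have g: "g n p = (\<Sum>w | length w = n.
      f (\<lambda>k. if k < n then w ! k else undefined) * word_weight p w)" if "p \<in> prob_simplex" for n p
    using that by (simp add: g_def integral_truncate_path bernoulli_measure)
  show "\<forall>\<^sub>F n in sequentially. continuous_on prob_simplex (g n)"
  proof (rule always_eventually, rule allI)
    fix n
    have "continuous_on prob_simplex (\<lambda>p. \<Sum>w | length w = n.
      f (\<lambda>k. if k < n then w ! k else undefined) * word_weight p w)"
      by (intro continuous_intros continuous_on_word_weight)
    then show "continuous_on prob_simplex (g n)"
      by (rule continuous_on_eq) (simp add: g)
  qed
  obtain B where B: "\<And>\<omega>. \<bar>f \<omega>\<bar> \<le> B"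
    using f(2) by (auto simp: bounded_iff)
  have trunc: "continuous_map path_topology euclideanreal (\<lambda>\<omega>. f (truncate_path n \<omega>))" for n
  proof (rule continuous_map_finitely_many_coordinates)
    fix \<omega> \<omega>' :: "nat \<Rightarrow> 's" assume "\<forall>k<n. \<omega> k = \<omega>' k"
    then have "truncate_path n \<omega> = truncate_path n \<omega>'" by (auto simp: truncate_path_def)
    then show "f (truncate_path n \<omega>) = f (truncate_path n \<omega>')" by simp
  qed
  show "uniform_limit prob_simplex g (\<lambda>p. \<integral>\<omega>. f \<omega> \<partial>bernoulli_measure p) sequentially"
    unfolding uniform_limit_sequentially_iff
  proof (intro allI impI)
    fix e :: real assume "e > 0"
    then obtain N where N: "\<And>n \<omega>. n \<ge> N \<Longrightarrow> \<bar>f (truncate_path n \<omega>) - f \<omega>\<bar> < e / 2"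
      using truncate_path_uniform[OF f(1), of "e / 2"] by auto
    show "\<exists>N. \<forall>n\<ge>N. \<forall>p\<in>prob_simplex. dist (g n p) (\<integral>\<omega>. f \<omega> \<partial>bernoulli_measure p) < e"
    proof (intro exI allI impI ballI)
      fix n and p :: "real ^ 's" assume n: "N \<le> n" and p: "p \<in> prob_simplex"
      note path = bernoulli_measure(1)[OF p]
      interpret prob_space "bernoulli_measure p" using path by (rule path_probabilitiesD)
      have meas: "h \<in> borel_measurable (bernoulli_measure p)"
        if "continuous_map path_topology euclideanreal h" for h
        using measurable_path_topology[OF that] measurable_cong_sets[OF path_probabilitiesD(2)[OF path] refl]
        by blast
      have int: "integrable (bernoulli_measure p) f"
        "integrable (bernoulli_measure p) (\<lambda>\<omega>. f (truncate_path n \<omega>))"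
        using B by (auto intro!: integrable_const_bound[of _ B] meas f(1) trunc)
      have "\<bar>g n p - (\<integral>\<omega>. f \<omega> \<partial>bernoulli_measure p)\<bar> =
          \<bar>\<integral>\<omega>. f (truncate_path n \<omega>) - f \<omega> \<partial>bernoulli_measure p\<bar>"
        by (simp add: g_def int)
      also have "\<dots> \<le> (\<integral>\<omega>. \<bar>f (truncate_path n \<omega>) - f \<omega>\<bar> \<partial>bernoulli_measure p)"
        by (rule integral_abs_bound)
      also have "\<dots> \<le> (\<integral>\<omega>. e / 2 \<partial>bernoulli_measure p)"
        using int N[OF n] by (intro integral_mono) (auto intro: less_imp_le)
      also have "\<dots> < e" using \<open>e > 0\<close> by (simp add: prob_space)
      finally show "dist (g n p) (\<integral>\<omega>. f \<omega> \<partial>bernoulli_measure p) < e"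
        by (simp add: dist_real_def)
    qed
  qed
qed simp

lemma continuous_map_bernoulli_measure:
  "continuous_map (top_of_set prob_simplex) weak_topology bernoulli_measure"
  unfolding weak_topology_def
proof (rule continuous_on_generated_topo)
  fix V :: "(nat \<Rightarrow> 'a) measure set"
  assume "V \<in> {{\<nu> \<in> path_probabilities. (\<integral>\<omega>. f \<omega> \<partial>\<nu>) \<in> U} | f U.
    continuous_map path_topology euclideanreal f \<and> bounded (range f) \<and> open U}"
  then obtain f U where V: "V = {\<nu> \<in> path_probabilities. (\<integral>\<omega>. f \<omega> \<partial>\<nu>) \<in> U}"
    and f: "continuous_map path_topology euclideanreal f" "bounded (range f)" and U: "open U"
    by blast
  have "bernoulli_measure -` V \<inter> topspace (top_of_set prob_simplex) =
      prob_simplex \<inter> (\<lambda>p. \<integral>\<omega>. f \<omega> \<partial>bernoulli_measure p) -` U"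
    using bernoulli_measure(1) by (auto simp: V)
  then show "openin (top_of_set prob_simplex)
      (bernoulli_measure -` V \<inter> topspace (top_of_set prob_simplex))"
    using continuous_openin_preimage_gen[OF continuous_on_bernoulli_integral[OF f] U] by simp
next
  show "bernoulli_measure ` topspace (top_of_set prob_simplex) \<subseteq>
    \<Union>{{\<nu> \<in> path_probabilities. (\<integral>\<omega>. f \<omega> \<partial>\<nu>) \<in> U} | f U.
      continuous_map path_topology euclideanreal f \<and> bounded (range f) \<and> open U}"
    unfolding topspace_weak_topology[unfolded weak_topology_def topology_generated_by_topspace]
    using bernoulli_measure(1) by auto
qed

lemma absolute_homeomorphic_central_weights:
  fixes S :: "'s::finite \<Rightarrow> 'a::ab_group_add"
  shows "homeomorphic_map (absolute_topology S) (top_of_set (central_weights S)) letter_weights"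
proof -
  have sub: "absolute S \<subseteq> path_probabilities"
    using central_measuresD(1) by (auto simp: absolute_def extreme_measure_def)
  have top: "topspace (absolute_topology S) = absolute S"
    using sub by (auto simp: absolute_topology_def topspace_weak_topology)
  have "homeomorphic_maps (absolute_topology S) (top_of_set (central_weights S))
      letter_weights bernoulli_measure"
    unfolding homeomorphic_maps_def
  proof (intro conjI ballI)
    show "continuous_map (absolute_topology S) (top_of_set (central_weights S)) letter_weights"
      unfolding continuous_map_in_subtopology
      using continuous_map_from_subtopology[OF continuous_map_letter_weights, of "absolute S"]
        absolute_bernoulli(1) top by (auto simp: absolute_topology_def)
    show "continuous_map (top_of_set (central_weights S)) (absolute_topology S) bernoulli_measure"
      unfolding absolute_topology_def continuous_map_in_subtopology
    proof
      have "top_of_set (central_weights S) = subtopology (top_of_set prob_simplex) (central_weights S)"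
        using central_weightsD(1) by (metis subsetI subtopology_subtopology inf.absorb2)
      then show "continuous_map (top_of_set (central_weights S)) weak_topology bernoulli_measure"
        using continuous_map_from_subtopology[OF continuous_map_bernoulli_measure] by metis
    qed (use bernoulli_measure_in_absolute in auto)
  qed (auto simp: top absolute_bernoulli(2)
      intro: letter_weights_bernoulli_measure central_weightsD(1))
  then show ?thesis using homeomorphic_map_maps by blast
qed

text \<open>Cylinder probabilities are products of letter weights, so all of them are nonzero
  exactly when every letter has positive weight.\<close>

lemma letter_weights_main_part:
  fixes S :: "'s::finite \<Rightarrow> 'a::ab_group_add"
  shows "letter_weights ` absolute_main_part S = {p \<in> central_weights S. \<forall>s. 0 < p $ s}"
proof (intro equalityI subsetI)
  fix p assume "p \<in> letter_weights ` absolute_main_part S"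
  then obtain \<nu> where \<nu>: "\<nu> \<in> absolute S" "\<And>xs. measure \<nu> (cylinder xs) \<noteq> 0" "p = letter_weights \<nu>"
    by (auto simp: absolute_main_part_def)
  have "0 < p $ s" for s
    using \<nu>(2)[of "[s]"] measure_nonneg[of \<nu> "cylinder [s]"] by (simp add: \<nu>(3) letter_weights_def less_le)
  then show "p \<in> {p \<in> central_weights S. \<forall>s. 0 < p $ s}"
    using absolute_bernoulli(1)[OF \<nu>(1)] \<nu>(3) by simp
next
  fix p assume "p \<in> {p \<in> central_weights S. \<forall>s. 0 < p $ s}"
  then have p: "p \<in> central_weights S" "\<And>s. p $ s \<noteq> 0" by (auto simp: less_le)
  have "bernoulli_measure p \<in> absolute_main_part S"
    using bernoulli_measure_in_absolute[OF p(1)] p(2)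
    by (simp add: absolute_main_part_def bernoulli_measure(2)[OF central_weightsD(1)[OF p(1)]]
        word_weight_eq_0_iff)
  then show "p \<in> letter_weights ` absolute_main_part S"
    using letter_weights_bernoulli_measure[OF central_weightsD(1)[OF p(1)]] by (metis image_eqI)
qed

theorem theorem1:
  fixes S :: "'s::finite \<Rightarrow> 'a::ab_group_add"
  assumes "semigroup_generators S"
  shows "\<exists>f. homeomorphic_map (absolute_topology S)
               (subtopology (Euclidean_space (group_rank TYPE('a)))
                  (closed_disk (group_rank TYPE('a)))) f \<and>
             f ` absolute_main_part S =
               (Euclidean_space (group_rank TYPE('a))) interior_of
                  (closed_disk (group_rank TYPE('a)))"
proof -
  let ?d = "group_rank TYPE('a)"
  obtain m where m: "homeomorphic_map (top_of_set (central_weights S))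
      (subtopology (Euclidean_space ?d) (closed_disk ?d)) m"
    "m ` {p \<in> central_weights S. \<forall>s. 0 < p $ s} = Euclidean_space ?d interior_of closed_disk ?d"
    using central_weights_homeomorphic_closed_disk[OF assms] by blast
  have "homeomorphic_map (absolute_topology S)
      (subtopology (Euclidean_space ?d) (closed_disk ?d)) (m \<circ> letter_weights)"
    using absolute_homeomorphic_central_weights m(1) by (rule homeomorphic_map_compose)
  moreover have "(m \<circ> letter_weights) ` absolute_main_part S =
      Euclidean_space ?d interior_of closed_disk ?d"
    unfolding image_comp[symmetric] letter_weights_main_part m(2) ..
  ultimately show ?thesis by blast
qed

end
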